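(* If a graph $U$ contains every planar graph, then for every $t\in\mathbb{N}$, $U$ contains a subdivision of $K_t^t$; that is, $U$ contains $t$ distinct vertices $w_1,\dots,w_t$ and, for each pair $i<j$, $t$ paths between $w_i$ and $w_j$, such that all these $t\binom{t}{2}$ paths are pairwise internally vertex-disjoint and no internal vertex of any of them is among $w_1,\dots,w_t$.
   Context: All graphs are simple and countable; $U$ contains $H$ if $H$ is isomorphic to a subgraph of $U$. $K_t^t$ denotes the multigraph on $t$ vertices with $t$ parallel edges between every pair of vertices. *)

theory Defs
  imports "HOL-Analysis.Analysis"
begin

definition simple_graph :: "'a set \<Rightarrow> ('a \<Rightarrow> 'a \<Rightarrow> bool) \<Rightarrow> bool" where
  "simple_graph V E \<longleftrightarrow> (\<forall>x y. E x y \<longrightarrow> x \<in> V \<and> y \<in> V \<and> x \<noteq> y \<and> E y x)"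

definition contains_graph ::
  "'a set \<Rightarrow> ('a \<Rightarrow> 'a \<Rightarrow> bool) \<Rightarrow> 'b set \<Rightarrow> ('b \<Rightarrow> 'b \<Rightarrow> bool) \<Rightarrow> bool" where
  "contains_graph V E W F \<longleftrightarrow>
     (\<exists>f. inj_on f W \<and> f ` W \<subseteq> V \<and> (\<forall>x\<in>W. \<forall>y\<in>W. F x y \<longrightarrow> E (f x) (f y)))"

definition planar_graph :: "'a set \<Rightarrow> ('a \<Rightarrow> 'a \<Rightarrow> bool) \<Rightarrow> bool" where
  "planar_graph V E \<longleftrightarrow>
     (\<exists>(p :: 'a \<Rightarrow> complex) (\<gamma> :: 'a set \<Rightarrow> real \<Rightarrow> complex).
        inj_on p V \<and>
        (\<forall>x\<in>V. \<forall>y\<in>V. E x y \<longrightarrow>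
            arc (\<gamma> {x, y}) \<and>
            {pathstart (\<gamma> {x, y}), pathfinish (\<gamma> {x, y})} = {p x, p y} \<and>
            (\<forall>z\<in>V - {x, y}. p z \<notin> path_image (\<gamma> {x, y}))) \<and>
        (\<forall>x\<in>V. \<forall>y\<in>V. \<forall>u\<in>V. \<forall>v\<in>V. E x y \<longrightarrow> E u v \<longrightarrow> {x, y} \<noteq> {u, v} \<longrightarrow>
            path_image (\<gamma> {x, y}) \<inter> path_image (\<gamma> {u, v}) \<subseteq> p ` ({x, y} \<inter> {u, v})))"

definition graph_path :: "'a set \<Rightarrow> ('a \<Rightarrow> 'a \<Rightarrow> bool) \<Rightarrow> 'a list \<Rightarrow> bool" where
  "graph_path V E P \<longleftrightarrow> P \<noteq> [] \<and> distinct P \<and> set P \<subseteq> V \<and>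
     (\<forall>i. Suc i < length P \<longrightarrow> E (P ! i) (P ! Suc i))"

definition interior_vertices :: "'a list \<Rightarrow> 'a set" where
  "interior_vertices P = set (butlast (tl P))"

end

(*  Idea. For every set X of naturals take a triangulated spiral of fixed circumference N in which X
    decides the diagonals of infinitely many sparse quadrilaterals. If U contains all these planar
    graphs, then, U being countable, there is an embedding f of one of them and embeddings g of others
    that agree with f on arbitrarily long initial parts. At the first difference g yields a path in U
    outside the image of f joining two vertices that are not adjacent in the spiral: a jump.
    (A vertex outside the spiral with infinitely many neighbours on it might lie on all these jumps;
    t such vertices already give the subdivision, and if there are fewer, then uncountably many
    embeddings share and hence avoid them.)
    Disjoint paths that follow the spiral keep their cyclic order, but a jump exchanges two
    neighbouring paths. So t^3 paths, starting from t centres of fans, can be brought into any cyclic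
    order, in particular one in which the paths to be joined are neighbours.  *)

theory Submission
  imports Defs
begin

section \<open>Planarity of spiral graphs\<close>

text \<open>A single spiral graph gives nothing, since its embedding may be free of jumps; only the
  clash between uncountably many sets \<open>X\<close> and countably many finite pieces of
  embeddings yields one. Numbering the vertices along the spiral has three uses: a first difference
  makes sense, the number is a clock for the moving paths, and its residue modulo \<open>N\<close>
  is the track that a path occupies. The obstacle is that nothing is known about the length of a
  jump. It may land many turns ahead, so the jumping path has to wait there until the others catch
  up. It may also land in its own class or in a neighbouring one, passing over no other path. A
  short jump of this kind is the missing diagonal of a quadrilateral and is used together with the
  present one; a long one leaves time for the other path to slide past. By the pigeonhole principle
  the jumps can be taken of one type modulo \<open>N\<close>, and the paths can be prepared for it
  because they can occupy any classes compatible with their cyclic order.\<close>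

definition spiral_point :: "nat \<Rightarrow> real \<Rightarrow> real \<Rightarrow> complex" where
  "spiral_point N s h = exp (Complex (s / N + h) (2 * pi * s / N))"

text \<open>\<open>exp\<close> is the universal cover of the punctured plane; in the coordinates
  \<open>(s, h)\<close> its deck group is generated by a full turn, which lowers \<open>s\<close> by
  \<open>N\<close> and raises \<open>h\<close> by 1.\<close>

lemma spiral_point_eqD:
  assumes "spiral_point N s h = spiral_point N s' h'" and "0 < N"
  obtains k :: int where "s' = s - k * N" and "h' = h + k"
proof -
  from assms(1)[symmetric, unfolded spiral_point_def exp_eq] obtain n :: int where
    n: "Complex (s' / N + h') (2 * pi * s' / N) =
        Complex (s / N + h) (2 * pi * s / N) + (of_int (2 * n) * pi) * \<i>"
    by blast
  from n have re: "s' / N + h' = s / N + h" and im: "2 * pi * s' / N = 2 * pi * s / N + 2 * n * pi"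
    by (auto simp: complex_eq_iff)
  from im have "2 * pi * (s' / N) = 2 * pi * (s / N + n)" by (simp add: algebra_simps)
  then have a: "s' / N = s / N + n" by (rule mult_left_cancel[THEN iffD1, rotated]) simp
  have "s' = s - (- n) * N"
    using a \<open>0 < N\<close> by (simp add: field_simps)
  moreover have "h' = h + (- n)"
    using a re by simp
  ultimately show ?thesis using that[of "- n"] by simp
qed

lemma spiral_point_shift:
  "0 < N \<Longrightarrow> spiral_point N (s - real N) (h + 1) = spiral_point N s h"
proof -
  assume "0 < N"
  then have "Complex ((s - real N) / N + (h + 1)) (2 * pi * (s - real N) / N) =
     Complex (s / N + h) (2 * pi * s / N) + (of_int (2 * (-1)) * pi) * \<i>"
    by (simp add: complex_eq_iff field_simps)
  then show ?thesis unfolding spiral_point_def exp_eq by blast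
qed

text \<open>Edges that leave the spiral line end at the copy \<open>(b - N, 1)\<close> of
  \<open>(b, 0)\<close>; a radial edge \<open>b = a + N\<close> is thus a vertical segment.\<close>

definition edge_column :: "nat \<Rightarrow> nat \<Rightarrow> nat \<Rightarrow> real \<Rightarrow> real" where
  "edge_column N a b u = a + (if b = a + 1 then 1 else real b - N - a) * u"

definition edge_height :: "nat \<Rightarrow> nat \<Rightarrow> real \<Rightarrow> real" where
  "edge_height a b u = (if b = a + 1 then 0 else u)"

definition edge_curve :: "nat \<Rightarrow> nat \<Rightarrow> nat \<Rightarrow> real \<Rightarrow> complex" where
  "edge_curve N a b u = spiral_point N (edge_column N a b u) (edge_height a b u)"

lemma edge_curve_0: "edge_curve N a b 0 = spiral_point N a 0"
  by (simp add: edge_curve_def edge_column_def edge_height_def)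

lemma edge_curve_1: "0 < N \<Longrightarrow> edge_curve N a b 1 = spiral_point N b 0"
  using spiral_point_shift[of N "real b" 0]
  by (auto simp: edge_curve_def edge_column_def edge_height_def add.commute)

lemma path_edge_curve: "0 < N \<Longrightarrow> path (edge_curve N a b)"
  unfolding path_def edge_curve_def[abs_def] spiral_point_def Complex_eq edge_column_def edge_height_def
  by (cases "b = a + 1") (auto intro!: continuous_intros)

lemma int_in_unit_interval:
  assumes "0 \<le> u" "u \<le> 1" "u = real_of_int k" shows "u = 0 \<or> u = 1"
proof -
  have "0 \<le> k" "k \<le> 1" using assms by auto
  then have "k = 0 \<or> k = 1" by auto
  then show ?thesis using assms by auto
qed

lemma spiral_vertex_inj:
  assumes "spiral_point N (real a) 0 = spiral_point N (real b) 0" "0 < N" shows "a = b"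
proof -
  from assms obtain k :: int where "real b = real a - k * N" "0 = 0 + real_of_int k"
    by (elim spiral_point_eqD)
  then show ?thesis by simp
qed

lemma edge_curve_vertex:
  assumes "edge_curve N a b u = spiral_point N (real z) 0" and N: "0 < N" and "u \<in> {0..1}"
  shows "z \<in> {a, b}"
proof -
  from assms obtain k :: int where
    k: "real z = edge_column N a b u - k * N" "0 = edge_height a b u + k"
    unfolding edge_curve_def by (elim spiral_point_eqD)
  have "u = 0 \<or> u = 1"
  proof (cases "b = a + 1")
    case True
    then have "u = real_of_int (int z - int a)"
      using k by (simp add: edge_column_def edge_height_def)
    then show ?thesis using int_in_unit_interval assms(3) by auto
  next
    case False
    then have "u = real_of_int (- k)" using k by (simp add: edge_height_def)
    then show ?thesis using int_in_unit_interval assms(3) by auto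
  qed
  then show ?thesis
  proof
    assume "u = 0"
    then show ?thesis using assms(1) edge_curve_0 spiral_vertex_inj[OF _ N] by simp
  next
    assume "u = 1"
    then show ?thesis using assms(1) edge_curve_1[OF N] spiral_vertex_inj[OF _ N] by simp
  qed
qed

text \<open>Read modulo the deck transformation \<open>(s, h) \<mapsto> (s - N, h + 1)\<close>, an edge is either the horizontal
  segment from \<open>(a, 0)\<close> to \<open>(a + 1, 0)\<close> or crosses the strip \<open>0 \<le> h \<le> 1\<close> from \<open>(a, 0)\<close> to
  \<open>(b - N, 1)\<close>; two crossing segments whose endpoints are ordered alike on both sides of the strip
  meet in endpoints only.\<close>

lemma edge_curve_meet:
  assumes N: "0 < N"
    and ab: "b = a + 1 \<or> N \<le> b" and ab': "b' = a' + 1 \<or> N \<le> b'"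
    and u: "u \<in> {0..1}" and u': "u' \<in> {0..1}"
    and nc: "b \<noteq> a + 1 \<Longrightarrow> b' \<noteq> a' + 1 \<Longrightarrow> (a \<le> a' \<and> b \<le> b') \<or> (a' \<le> a \<and> b' \<le> b)"
    and eq: "edge_curve N a b u = edge_curve N a' b' u'"
  shows "(a = a' \<and> b = b' \<and> u = u') \<or> (u \<in> {0, 1} \<and> u' \<in> {0, 1})"
proof -
  from eq N obtain k :: int where
    k: "edge_column N a' b' u' = edge_column N a b u - k * N"
       "edge_height a' b' u' = edge_height a b u + k"
    unfolding edge_curve_def by (elim spiral_point_eqD)
  have int_end: "v \<in> {0, 1}" if "v \<in> {0..1}" "v = real_of_int j" for v j
    using int_in_unit_interval that by auto
  consider (hh) "b = a + 1" "b' = a' + 1" | (hu) "b = a + 1" "b' \<noteq> a' + 1"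
    | (uh) "b \<noteq> a + 1" "b' = a' + 1" | (uu) "b \<noteq> a + 1" "b' \<noteq> a' + 1" by blast
  then show ?thesis
  proof cases
    case hh
    then have kk: "k = 0" "real a' + u' = real a + u"
      using k by (simp_all add: edge_column_def edge_height_def)
    then have d: "u - u' = real_of_int (int a' - int a)" by simp
    show ?thesis
    proof (cases "a = a'")
      case True
      then show ?thesis using hh d by simp
    next
      case False
      then have "\<bar>u - u'\<bar> \<ge> 1" unfolding d by linarith
      then have "(u = 0 \<and> u' = 1) \<or> (u = 1 \<and> u' = 0)" using u u' by auto
      then show ?thesis by auto
    qed
  next
    case hu
    then have "u' = real_of_int k" using k by (simp add: edge_height_def)
    with u' have e: "u' = 0 \<or> u' = 1" using int_in_unit_interval by auto
    have "u = real_of_int ((if u' = 0 then int a' else int b' - int N) + k * int N - int a)"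
      using k hu e by (auto simp: edge_column_def)
    then show ?thesis using int_end[OF u] e by blast
  next
    case uh
    then have "u = real_of_int (- k)" using k by (simp add: edge_height_def)
    with u have e: "u = 0 \<or> u = 1" using int_in_unit_interval by auto
    have "u' = real_of_int ((if u = 0 then int a else int b - int N) - k * int N - int a')"
      using k uh e by (auto simp: edge_column_def)
    then show ?thesis using int_end[OF u'] e by blast
  next
    case uu
    then have kk: "u' = u + k" using k by (simp add: edge_height_def)
    show ?thesis
    proof (cases "k = 0")
      case False
      then have "\<bar>u' - u\<bar> \<ge> 1" using kk by linarith
      then have "(u = 0 \<and> u' = 1) \<or> (u = 1 \<and> u' = 0)" using u u' by auto
      then show ?thesis by auto
    next
      case True
      then have uu': "u' = u" using kk by simp
      \<comment> \<open>At a common height the columns differ by a convex combination of the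
        differences at the two ends. Noncrossing gives both summands the same sign, so both
        vanish.\<close>
      have "(1 - u) * (real a' - a) + u * (real b' - b) = 0"
        using k True uu uu' by (simp add: edge_column_def algebra_simps)
      moreover have "0 \<le> 1 - u" "0 \<le> u" using u by auto
      ultimately have "(1 - u) * (real a' - a) = 0 \<and> u * (real b' - b) = 0"
      proof (cases "a \<le> a' \<and> b \<le> b'")
        case True
        then have "0 \<le> (1 - u) * (real a' - a)" "0 \<le> u * (real b' - b)"
          using \<open>0 \<le> 1 - u\<close> \<open>0 \<le> u\<close> by simp_all
        then show ?thesis using \<open>(1 - u) * (real a' - a) + u * (real b' - b) = 0\<close> by linarith
      next
        case False
        then have "a' \<le> a" "b' \<le> b" using nc uu by auto
        then have "(1 - u) * (real a' - a) \<le> 0" "u * (real b' - b) \<le> 0"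
          using \<open>0 \<le> 1 - u\<close> \<open>0 \<le> u\<close> by (simp_all add: mult_nonneg_nonpos)
        then show ?thesis using \<open>(1 - u) * (real a' - a) + u * (real b' - b) = 0\<close> by linarith
      qed
      then show ?thesis using uu' by auto
    qed
  qed
qed

theorem spiral_graph_planar:
  fixes F :: "nat \<Rightarrow> nat \<Rightarrow> bool" and N :: nat
  assumes N: "0 < N"
    and symF: "\<And>x y. F x y \<Longrightarrow> F y x" and irr: "\<And>x. \<not> F x x"
    and up: "\<And>x y. F x y \<Longrightarrow> x < y \<Longrightarrow> y = x + 1 \<or> N \<le> y"
    and nc: "\<And>x y x' y'. F x y \<Longrightarrow> F x' y' \<Longrightarrow> x < x' \<Longrightarrow> x + 1 < y \<Longrightarrow> x' + 1 < y' \<Longrightarrow> y \<le> y'"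
  shows "planar_graph UNIV F"
proof -
  define p where "p = (\<lambda>a::nat. spiral_point N (real a) 0)"
  define \<gamma> where "\<gamma> = (\<lambda>e::nat set. edge_curve N (Min e) (Max e))"
  have wf: "\<exists>a b. a < b \<and> F a b \<and> {x, y} = {a, b} \<and> \<gamma> {x, y} = edge_curve N a b" if "F x y" for x y
  proof -
    have "x < y \<or> y < x" using irr that by (metis linorder_neqE_nat)
    then show ?thesis
    proof
      assume "x < y"
      then show ?thesis using that by (intro exI[of _ x] exI[of _ y]) (simp add: \<gamma>_def)
    next
      assume "y < x"
      then show ?thesis using symF[OF that]
        by (intro exI[of _ y] exI[of _ x]) (auto simp add: \<gamma>_def insert_commute)
    qed
  qed
  have meet: "(a = a' \<and> b = b' \<and> u = u') \<or> (u \<in> {0, 1} \<and> u' \<in> {0, 1})"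
    if "F a b" "a < b" "F a' b'" "a' < b'" "u \<in> {0..1}" "u' \<in> {0..1}"
      "edge_curve N a b u = edge_curve N a' b' u'" for a b a' b' u u'
  proof (rule edge_curve_meet[OF N _ _ that(5,6) _ that(7)])
    show "b = a + 1 \<or> N \<le> b" "b' = a' + 1 \<or> N \<le> b'" using up that by blast+
    assume "b \<noteq> a + 1" "b' \<noteq> a' + 1"
    then have "a + 1 < b" "a' + 1 < b'" using that by auto
    then show "(a \<le> a' \<and> b \<le> b') \<or> (a' \<le> a \<and> b' \<le> b)"
      using nc[OF that(1,3)] nc[OF that(3,1)] by (cases a a' rule: linorder_cases) auto
  qed
  have arcs: "arc (edge_curve N a b)" if "F a b" "a < b" for a b
  proof -
    have "u = u'" if u: "u \<in> {0..1}" "u' \<in> {0..1}" "edge_curve N a b u = edge_curve N a b u'" for u u'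
    proof (rule ccontr)
      assume "u \<noteq> u'"
      with meet[OF \<open>F a b\<close> \<open>a < b\<close> \<open>F a b\<close> \<open>a < b\<close> u] have
        "(u = 0 \<and> u' = 1) \<or> (u = 1 \<and> u' = 0)" by auto
      then have "spiral_point N a 0 = spiral_point N b 0"
        using u(3) edge_curve_0 edge_curve_1[OF N] by metis
      then show False using spiral_vertex_inj[OF _ N] \<open>a < b\<close> by blast
    qed
    then show ?thesis unfolding arc_def inj_on_def using path_edge_curve[OF N] by blast
  qed
  have ends: "pathstart (edge_curve N a b) = p a" "pathfinish (edge_curve N a b) = p b" for a b
    by (simp_all add: pathstart_def pathfinish_def p_def edge_curve_0 edge_curve_1[OF N])
  show ?thesis
    unfolding planar_graph_def
  proof (intro exI[of _ p] exI[of _ \<gamma>] conjI ballI impI)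
    show "inj p" by (auto simp: inj_def p_def intro: spiral_vertex_inj[OF _ N])
  next
    fix x y assume "F x y"
    then obtain a b where ab: "a < b" "F a b" "{x, y} = {a, b}" "\<gamma> {x, y} = edge_curve N a b"
      using wf by blast
    show "arc (\<gamma> {x, y})" unfolding ab(4) by (rule arcs[OF ab(2,1)])
    show "{pathstart (\<gamma> {x, y}), pathfinish (\<gamma> {x, y})} = {p x, p y}"
    proof -
      have "p ` {x, y} = p ` {a, b}" by (rule arg_cong[OF ab(3)])
      then show ?thesis unfolding ab(4) ends by simp
    qed
    fix z assume "z \<in> UNIV - {x, y}"
    then show "p z \<notin> path_image (\<gamma> {x, y})"
      using edge_curve_vertex[OF sym N] ab(3) unfolding path_image_def ab(4) p_def
      by blast
  next
    fix x y x' y' assume F: "F x y" "F x' y'" "{x, y} \<noteq> {x', y'}"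
    obtain a b where ab: "a < b" "F a b" "{x, y} = {a, b}" "\<gamma> {x, y} = edge_curve N a b"
      using wf F by blast
    obtain a' b' where ab': "a' < b'" "F a' b'" "{x', y'} = {a', b'}" "\<gamma> {x', y'} = edge_curve N a' b'"
      using wf F by blast
    show "path_image (\<gamma> {x, y}) \<inter> path_image (\<gamma> {x', y'}) \<subseteq> p ` ({x, y} \<inter> {x', y'})"
    proof
      fix q assume "q \<in> path_image (\<gamma> {x, y}) \<inter> path_image (\<gamma> {x', y'})"
      then obtain u u' where u: "u \<in> {0..1}" "u' \<in> {0..1}" "q = edge_curve N a b u"
        "q = edge_curve N a' b' u'"
        unfolding ab(4) ab'(4) path_image_def by blast
      have "\<not> (a = a' \<and> b = b')" using F(3) unfolding ab(3) ab'(3) by blast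
      then have "u \<in> {0, 1} \<and> u' \<in> {0, 1}"
        using meet[OF ab(2,1) ab'(2,1) u(1,2)] u(3,4) by blast
      moreover have "edge_curve N a b u = (if u = 0 then p a else p b)" if "u \<in> {0, 1}" for a b u
        using that by (auto simp: p_def edge_curve_0 edge_curve_1[OF N])
      ultimately have "q = p a \<or> q = p b" "q = p a' \<or> q = p b'"
        using u(3,4) by presburger+
      then obtain c c' where "c \<in> {a, b}" "q = p c" "c' \<in> {a', b'}" "q = p c'"
        by blast
      moreover from this have "c = c'"
        using spiral_vertex_inj[OF _ N, of c c'] unfolding p_def by simp
      ultimately show "q \<in> p ` ({x, y} \<inter> {x', y'})" unfolding ab(3) ab'(3) by blast
    qed
  qed
qed

section \<open>A family of spiral graphs\<close>

text \<open>Vertex \<open>n \<ge> N\<close> sits at turn \<open>n div N\<close> of a spiral. The quadrilateral with corners \<open>p\<close>, \<open>p + 1\<close>,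
  \<open>p + N\<close>, \<open>p + N + 1\<close> carries one of its two diagonals; \<open>X\<close> selects the other diagonal at sparse
  places. The vertices \<open>i * t\<^sup>2\<close> with \<open>i < t\<close> are the centres of fans attached to the first turn.\<close>

definition flipped :: "nat \<Rightarrow> nat set \<Rightarrow> nat \<Rightarrow> bool" where
  "flipped N X p \<longleftrightarrow> (\<exists>j\<in>X. p = 2 * N * (j + 1))"

definition spiral_up :: "nat \<Rightarrow> nat \<Rightarrow> nat set \<Rightarrow> nat \<Rightarrow> nat \<Rightarrow> bool" where
  "spiral_up t N X x y \<longleftrightarrow>
     N \<le> x \<and> (y = x + 1 \<or> y = x + N \<or> (y = x + N + 1 \<and> \<not> flipped N X x) \<or>
              (y + 1 = x + N \<and> flipped N X (x - 1))) \<or>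
     (\<exists>i<t. x = i * t\<^sup>2 \<and> N + i * t\<^sup>2 \<le> y \<and> y < N + (i + 1) * t\<^sup>2)"

definition spiral_adj :: "nat \<Rightarrow> nat \<Rightarrow> nat set \<Rightarrow> nat \<Rightarrow> nat \<Rightarrow> bool" where
  "spiral_adj t N X x y \<longleftrightarrow> spiral_up t N X x y \<or> spiral_up t N X y x"

text \<open>Flips occur only at positive multiples of \<open>2 * N\<close>, so consecutive
  quadrilaterals are never both flipped, not even with respect to two different sets.\<close>

lemma flipped_neighbours:
  assumes "flipped N X p" "2 \<le> N" shows "\<not> flipped N Y (p + 1)" "2 * N \<le> p"
proof -
  from assms obtain j where j: "p = 2 * N * (j + 1)" by (auto simp: flipped_def)
  show "2 * N \<le> p" using j by simp
  show "\<not> flipped N Y (p + 1)"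
  proof
    assume "flipped N Y (p + 1)"
    then obtain k where "p + 1 = 2 * N * (k + 1)" by (auto simp: flipped_def)
    then have "2 * N dvd p + 1" "2 * N dvd p" using j by (metis dvd_triv_left)+
    then have "2 * N dvd 1" by (metis dvd_add_right_iff)
    then show False using assms(2) by simp
  qed
qed

locale spiral =
  fixes t N :: nat
  assumes N_big: "2 * t ^ 3 + 10 \<le> N"
begin

lemma fan_bound: "i < t \<Longrightarrow> (i + 1) * t\<^sup>2 \<le> t ^ 3"
proof -
  assume "i < t"
  then have "(i + 1) * t\<^sup>2 \<le> t * t\<^sup>2" by (intro mult_right_mono) auto
  then show ?thesis by (simp add: power2_eq_square power3_eq_cube)
qed

lemma spiral_up_less: "spiral_up t N X x y \<Longrightarrow> x < y"
  using N_big fan_bound unfolding spiral_up_def by fastforce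

lemma spiral_adj_less: "x < y \<Longrightarrow> spiral_adj t N X x y \<longleftrightarrow> spiral_up t N X x y"
  using spiral_up_less unfolding spiral_adj_def by fastforce

lemma spiral_adj_sym: "spiral_adj t N X x y \<Longrightarrow> spiral_adj t N X y x"
  unfolding spiral_adj_def by blast

lemma simple_spiral: "simple_graph UNIV (spiral_adj t N X)"
  using spiral_up_less unfolding simple_graph_def spiral_adj_def by fastforce

lemma spiral_up_far:
  assumes "N \<le> x"
  shows "spiral_up t N X x y \<longleftrightarrow> y = x + 1 \<or> y = x + N \<or> (y = x + N + 1 \<and> \<not> flipped N X x) \<or>
              (y + 1 = x + N \<and> flipped N X (x - 1))"
proof -
  have "x \<noteq> i * t\<^sup>2" if "i < t" for i
    using fan_bound[OF that] assms N_big by auto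
  then show ?thesis using assms unfolding spiral_up_def by blast
qed

text \<open>Endpoints could be inverted only at a flip, where \<open>x + 1\<close> reaches back to
  \<open>x + N\<close>; but then \<open>x\<close> has lost its diagonal to \<open>x + N + 1\<close>.
  Fan edges end before \<open>N + t ^ 3\<close>, below all targets of long edges that start at
  \<open>N\<close> or later.\<close>

lemma spiral_noncrossing:
  assumes "spiral_up t N X x y" "spiral_up t N X x' y'" "x < x'" "x + 1 < y" "x' + 1 < y'"
  shows "y \<le> y'"
proof (cases "N \<le> x'")
  case far': True
  then have y': "y' = x' + N \<or> y' = x' + N + 1 \<or> (y' + 1 = x' + N \<and> flipped N X (x' - 1))"
    using assms spiral_up_far by auto
  show ?thesis
  proof (cases "N \<le> x")
    case True
    then have "y = x + N \<or> (y = x + N + 1 \<and> \<not> flipped N X x) \<or> y + 1 = x + N"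
      using assms spiral_up_far by auto
    moreover have "x' - 1 = x" if "x' < x + 2" using that assms(3) by simp
    ultimately show ?thesis using y' assms(3) by (cases "x' < x + 2") auto
  next
    case False
    then obtain i where i: "i < t" "y < N + (i + 1) * t\<^sup>2"
      using assms(1) unfolding spiral_up_def by auto
    then show ?thesis using fan_bound[OF i(1)] y' far' N_big by auto
  qed
next
  case False
  then obtain i i' where i: "i < t" "x = i * t\<^sup>2" "y < N + (i + 1) * t\<^sup>2"
    and i': "x' = i' * t\<^sup>2" "N + i' * t\<^sup>2 \<le> y'"
    using assms unfolding spiral_up_def by auto
  then have "i < i'" using assms(3) by (metis mult_le_mono1 not_less)
  then have "(i + 1) * t\<^sup>2 \<le> i' * t\<^sup>2" by (intro mult_right_mono) auto
  then show ?thesis using i i' by linarith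
qed

lemma planar_spiral: "planar_graph UNIV (spiral_adj t N X)"
proof (rule spiral_graph_planar)
  show "0 < N" using N_big by simp
  show "spiral_adj t N X y x" if "spiral_adj t N X x y" for x y
    using that by (rule spiral_adj_sym)
  show "\<not> spiral_adj t N X x x" for x
    using spiral_up_less unfolding spiral_adj_def by blast
  show "y = x + 1 \<or> N \<le> y" if "spiral_adj t N X x y" "x < y" for x y
    using that unfolding spiral_adj_less[OF that(2)] by (auto simp: spiral_up_def)
  show "y \<le> y'" if "spiral_adj t N X x y" "spiral_adj t N X x' y'" "x < x'" "x + 1 < y" "x' + 1 < y'"
    for x y x' y'
    using that spiral_noncrossing spiral_adj_less by simp
qed

end

section \<open>Jumps\<close>

definition jump :: "'a set \<Rightarrow> ('a \<Rightarrow> 'a \<Rightarrow> bool) \<Rightarrow> (nat \<Rightarrow> 'a) \<Rightarrow> nat \<Rightarrow> nat \<Rightarrow> 'a list \<Rightarrow> bool" where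
  "jump V E f v w Zs \<longleftrightarrow> distinct Zs \<and> set Zs \<subseteq> V - range f \<and> successively E (f v # Zs @ [f w])"

lemma jump_edge: "E (f v) (f w) \<Longrightarrow> jump V E f v w []"
  by (simp add: jump_def)

context spiral begin

text \<open>Both embeddings agree up to the first difference \<open>n\<close>. There, \<open>g n\<close> is joined to the same earlier
  vertices as \<open>f n\<close>; wherever it lies, it spoils the planar drawing of the spiral given by \<open>f\<close>.\<close>

lemma jump_of_first_difference:
  assumes symE: "\<And>x y. E x y \<Longrightarrow> E y x"
    and f: "inj f" "\<And>x y. spiral_adj t N X x y \<Longrightarrow> E (f x) (f y)"
    and g: "inj g" "\<And>x y. spiral_adj t N Y x y \<Longrightarrow> E (g x) (g y)" "range g \<subseteq> V"
    and n: "2 * N + 1 \<le> n" and same: "\<And>j. j < n \<Longrightarrow> f j = g j"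
    and diff: "f n \<noteq> g n \<or> flipped N X (n - N - 1) \<noteq> flipped N Y (n - N - 1)"
  shows "\<exists>v w Zs. n \<le> v + N + 1 \<and> v < w \<and> \<not> spiral_adj t N X v w \<and> jump V E f v w Zs \<and>
    set Zs \<subseteq> range g \<and> (\<forall>z\<in>set Zs. \<exists>j. n \<le> j + N + 1 \<and> E z (f j))"
proof -
  \<comment> \<open>The quadrilateral \<open>q\<close>, \<open>q + 1\<close>, \<open>q + N\<close>,
    \<open>n\<close> is the one that \<open>n\<close> completes.\<close>
  define q where "q = n - N - 1"
  have nq: "n = q + N + 1" "N \<le> q" "10 \<le> N" using n N_big by (auto simp: q_def)
  note up = spiral_adj_less spiral_up_far
  have witness: ?thesis if "n \<le> v + N + 1" "v < w" "\<not> spiral_adj t N X v w" "jump V E f v w Zs"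
    "set Zs \<subseteq> range g" "\<And>z. z \<in> set Zs \<Longrightarrow> E z (f v) \<or> E z (f w)" for v w Zs
  proof -
    have "n \<le> w + N + 1" using that(1,2) by simp
    then have "\<forall>z\<in>set Zs. \<exists>j. n \<le> j + N + 1 \<and> E z (f j)" using that(1,6) by blast
    then show ?thesis using that(1-5) by blast
  qed
  have edge: ?thesis if "n \<le> v + N + 1" "v < w" "\<not> spiral_adj t N X v w" "E (f v) (f w)" for v w
    using that jump_edge[of E f v w V] by (intro witness[of v w "[]"]) simp_all
  have Y1: "spiral_adj t N Y (q + N) n" "spiral_adj t N Y (q + 1) n"
    using nq by (simp_all add: up)
  have E1: "E (f (q + N)) (g n)" "E (f (q + 1)) (g n)"
    using g(2)[OF Y1(1)] g(2)[OF Y1(2)] same nq by simp_all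
  consider (flip) "g n = f n" | (old) y where "g n = f y" "y \<noteq> n" | (new) "g n \<notin> range f" by blast
  then show ?thesis
  proof cases
    case flip
    then have fl: "flipped N X q \<noteq> flipped N Y q" using diff q_def by simp
    show ?thesis
    proof (cases "flipped N Y q")
      case True
      then have "spiral_adj t N Y (q + 1) (q + N)" using nq by (simp add: up)
      then have "E (g (q + 1)) (g (q + N))" by (rule g(2))
      then have "E (f (q + 1)) (f (q + N))" using same nq by simp
      moreover have "\<not> spiral_adj t N X (q + 1) (q + N)" using nq True fl by (simp add: up)
      ultimately show ?thesis using edge[of "q + 1" "q + N"] nq by simp
    next
      case False
      then have "spiral_adj t N Y q n" using nq by (simp add: up)
      then have "E (g q) (g n)" by (rule g(2))
      then have "E (f q) (f n)" using same nq flip by simp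
      moreover have "\<not> spiral_adj t N X q n" using nq False fl by (simp add: up)
      ultimately show ?thesis using edge[of q n] nq by simp
    qed
  next
    case (old y)
    have "n < y"
    proof (rule ccontr)
      assume "\<not> n < y"
      then have "g y = g n" using old same by simp
      then show False using old injD[OF g(1), of y n] by simp
    qed
    \<comment> \<open>Beyond \<open>n\<close>, the vertex \<open>q + 1\<close> can only see
      \<open>n + 1\<close>, which is not adjacent to \<open>q + N = n - 1\<close>.\<close>
    then have "\<not> spiral_adj t N X (q + N) y \<or> \<not> spiral_adj t N X (q + 1) y"
      using nq by (auto simp: up)
    then show ?thesis using edge[of "q + N" y] edge[of "q + 1" y] E1 old \<open>n < y\<close> nq by auto
  next
    case new
    have zV: "g n \<in> V - range f" using new g(3) by auto
    show ?thesis
    proof (cases "flipped N X q")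
      case False
      then have "\<not> spiral_adj t N X (q + 1) (q + N)" using nq by (simp add: up)
      moreover have "jump V E f (q + 1) (q + N) [g n]"
        using zV E1 symE by (auto simp: jump_def)
      moreover have "E (g n) (f (q + 1))" using E1 symE by blast
      ultimately show ?thesis using nq
          by (intro witness[of "q + 1" "q + N" "[g n]"]) auto
    next
      case True
      \<comment> \<open>Here \<open>q + 1\<close> and \<open>q + N\<close> are adjacent, so the
        detour through \<open>g n\<close> is no jump. The next quadrilateral is unflipped in both
        graphs, and \<open>g (n + 1)\<close> supplies a further connection.\<close>
      then have nofl: "\<not> flipped N Z (q + 1)" for Z using flipped_neighbours nq by simp
      have Y2: "spiral_adj t N Y n (n + 1)" "spiral_adj t N Y (q + 2) (n + 1)"
        "spiral_adj t N Y (q + 1) (n + 1)"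
        using nq nofl by (simp_all add: up)
      have E2: "E (g n) (g (n + 1))" "E (f (q + 2)) (g (n + 1))" "E (f (q + 1)) (g (n + 1))"
        using g(2)[OF Y2(1)] g(2)[OF Y2(2)] g(2)[OF Y2(3)] same nq by simp_all
      consider (same) "g (n + 1) = f (n + 1)" | (old) y where "g (n + 1) = f y" "y \<noteq> n + 1"
        | (new) "g (n + 1) \<notin> range f" by blast
      then show ?thesis
      proof cases
        case same
        have "\<not> spiral_adj t N X (q + N) (n + 1)" using nq by (simp add: up)
        moreover have "jump V E f (q + N) (n + 1) [g n]"
          using zV E1 E2 same by (auto simp: jump_def)
        moreover have "E (g n) (f (q + N))" using E1 symE by blast
        ultimately show ?thesis using nq
          by (intro witness[of "q + N" "n + 1" "[g n]"]) auto
      next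
        case (old y)
        have "n \<le> y"
        proof (rule ccontr)
          assume "\<not> n \<le> y"
          then have "g y = g (n + 1)" using old same by simp
          then show False using old injD[OF g(1), of y "n + 1"] by simp
        qed
        then show ?thesis
        proof (cases "y = n")
          case True
          have "\<not> spiral_adj t N X (q + 2) n" using nq nofl by (simp add: up)
          then show ?thesis using edge[of "q + 2" n] E2 old True nq by simp
        next
          case False
          then have "\<not> spiral_adj t N X (q + 1) y" using nq \<open>n \<le> y\<close> old by (simp add: up)
          then show ?thesis using edge[of "q + 1" y] E2 old \<open>n \<le> y\<close> nq by simp
        qed
      next
        case new2: new
        have z2: "g (n + 1) \<in> V - range f" "g (n + 1) \<noteq> g n"
          using new2 g(3) injD[OF g(1), of "n + 1" n] by auto
        have "\<not> spiral_adj t N X (q + 2) (q + N)" using nq by (simp add: up)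
        moreover have "jump V E f (q + 2) (q + N) [g (n + 1), g n]"
          using zV z2 E1 E2 symE by (auto simp: jump_def)
        moreover have "E (g n) (f (q + N))" "E (g (n + 1)) (f (q + 2))" using E1 E2 symE by blast+
        ultimately show ?thesis using nq
          by (intro witness[of "q + 2" "q + N" "[g (n + 1), g n]"]) auto
      qed
    qed
  qed
qed

text \<open>The least index where the embeddings or the diagonals completed there disagree is the
  first difference needed. It exists because an element \<open>j\<close> of only one of the sets
  flips the quadrilateral \<open>2 * N * (j + 1)\<close> in only one graph. The neighbours far out
  will later keep \<open>Zs\<close> away from a given finite set.\<close>

lemma jump_of_difference:
  assumes symE: "\<And>x y. E x y \<Longrightarrow> E y x"
    and f: "inj f" "\<And>x y. spiral_adj t N X x y \<Longrightarrow> E (f x) (f y)"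
    and g: "inj g" "\<And>x y. spiral_adj t N Y x y \<Longrightarrow> E (g x) (g y)" "range g \<subseteq> V"
    and m: "2 * N + 1 \<le> m" and same: "\<And>j. j < m \<Longrightarrow> f j = g j"
    and flips: "\<And>j. j < m \<Longrightarrow> j \<in> X \<longleftrightarrow> j \<in> Y" and "X \<noteq> Y"
  shows "\<exists>v w Zs. m \<le> v + N + 1 \<and> v < w \<and> \<not> spiral_adj t N X v w \<and> jump V E f v w Zs \<and>
    set Zs \<subseteq> range g \<and> (\<forall>z\<in>set Zs. \<exists>j. m \<le> j + N + 1 \<and> E z (f j))"
proof -
  define D where "D n \<longleftrightarrow> m \<le> n \<and> (f n \<noteq> g n \<or> flipped N X (n - N - 1) \<noteq> flipped N Y (n - N - 1))" for n
  from \<open>X \<noteq> Y\<close> obtain j where j: "j \<in> X \<longleftrightarrow> j \<notin> Y" by blast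
  then have "m \<le> j" using flips by (meson not_less)
  have N0: "0 < N" using N_big by simp
  have "flipped N Z (2 * N * (j + 1)) \<longleftrightarrow> j \<in> Z" for Z
    using N0 unfolding flipped_def by auto
  moreover have "1 * j \<le> (2 * N) * (j + 1)" using N0 by (intro mult_le_mono) auto
  ultimately have "D (2 * N * (j + 1) + N + 1)"
    using j \<open>m \<le> j\<close> unfolding D_def by simp
  define n where "n = (LEAST n. D n)"
  have "D n" unfolding n_def by (rule LeastI) fact
  have least: "\<not> D i" if "i < n" for i using that not_less_Least unfolding n_def by blast
  have "f i = g i" if "i < n" for i
    using least[OF that] same unfolding D_def by (meson not_less)
  moreover have "2 * N + 1 \<le> n" "m \<le> n" using \<open>D n\<close> m by (auto simp: D_def)
  ultimately have "\<exists>v w Zs. n \<le> v + N + 1 \<and> v < w \<and> \<not> spiral_adj t N X v w \<and> jump V E f v w Zs \<and>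
    set Zs \<subseteq> range g \<and> (\<forall>z\<in>set Zs. \<exists>j. n \<le> j + N + 1 \<and> E z (f j))"
    using \<open>D n\<close> jump_of_first_difference[where E=E and f=f and g=g and X=X and Y=Y and V=V and n=n]
    symE f g unfolding D_def by blast
  then show ?thesis using \<open>m \<le> n\<close> by (meson order_trans)
qed

end

section \<open>Moving disjoint paths along the spiral\<close>

lemma mod_eq_close:
  fixes x y N :: nat
  assumes "x mod N = y mod N" "x < y + N" "y < x + N" shows "x = y"
proof (cases "x \<le> y")
  case True
  then have "N dvd y - x" using assms(1) mod_eq_dvd_iff_nat[OF True, of N] by simp
  then show ?thesis using assms(3) True by (auto dest: dvd_imp_le)
next
  case False
  then have "N dvd x - y" using assms(1) mod_eq_dvd_iff_nat[of y x N] by simp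
  then show ?thesis using assms(2) False by (auto dest: dvd_imp_le)
qed

lemma graph_path_iff:
  "graph_path V E P \<longleftrightarrow> P \<noteq> [] \<and> distinct P \<and> set P \<subseteq> V \<and> successively E P"
  unfolding graph_path_def successively_conv_nth by auto

lemma mset_eq_by_adjacent_swaps:
  assumes swap: "\<And>us x y vs. R (us @ x # y # vs) \<Longrightarrow> R (us @ y # x # vs)"
    and "mset xs = mset ys" and "R xs"
  shows "R ys"
proof -
  have bubble: "R (us @ as @ y # bs) \<Longrightarrow> R (us @ y # as @ bs)" for us as y bs
  proof (induction as arbitrary: bs rule: rev_induct)
    case (snoc a as)
    then have "R ((us @ as) @ a # y # bs)" by simp
    then have "R ((us @ as) @ y # a # bs)" by (rule swap)
    then show ?case using snoc.IH[of "a # bs"] by simp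
  qed simp
  have "R (us @ xs) \<Longrightarrow> mset xs = mset ys \<Longrightarrow> R (us @ ys)" for us
  proof (induction ys arbitrary: us xs)
    case (Cons y ys)
    then have "y \<in> set xs" by (metis list.set_intros(1) mset_eq_setD)
    then obtain as bs where xs: "xs = as @ y # bs" by (metis split_list)
    then have "R ((us @ [y]) @ as @ bs)" using Cons.prems bubble by simp
    moreover have "mset (as @ bs) = mset ys" using Cons.prems xs by simp
    ultimately show ?case using Cons.IH[of "us @ [y]" "as @ bs"] by simp
  qed simp
  from this[of "[]"] show ?thesis using assms by simp
qed

text \<open>In \<open>jumps\<close>, the finite set \<open>Q\<close> stands for the outside vertices
  consumed by earlier jumps and \<open>m\<close> for the current time.\<close>

locale jumping_spiral = spiral +
  fixes V :: "'a set" and E :: "'a \<Rightarrow> 'a \<Rightarrow> bool" and f :: "nat \<Rightarrow> 'a" and X :: "nat set"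
  assumes symE: "E x y \<Longrightarrow> E y x"
    and inj_f: "inj f" and range_f: "range f \<subseteq> V"
    and hom_f: "spiral_adj t N X i j \<Longrightarrow> E (f i) (f j)"
    and jumps: "finite Q \<Longrightarrow> \<exists>v w Zs. m \<le> v \<and> v < w \<and> \<not> spiral_adj t N X v w \<and>
      jump V E f v w Zs \<and> set Zs \<inter> Q = {}"
begin

abbreviation M :: nat where "M \<equiv> t ^ 3"

text \<open>Only the tips and the stock of used vertices are visible: spiral indices in
  \<open>J\<close>, outside vertices in \<open>Z\<close>. An extension has to know no more about the
  paths.\<close>

definition linked :: "(nat \<Rightarrow> nat) \<Rightarrow> nat set \<Rightarrow> 'a set \<Rightarrow> bool" where
  "linked c J Z \<longleftrightarrow> (\<exists>P.
     (\<forall>k<M. graph_path V E (P k) \<and> hd (P k) = f (N + k) \<and> last (P k) = f (c k) \<and>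
        set (P k) \<subseteq> f ` J \<union> Z) \<and>
     (\<forall>k<M. \<forall>l<M. k \<noteq> l \<longrightarrow> set (P k) \<inter> set (P l) = {}))"

lemma linked_mono: "linked c J Z \<Longrightarrow> J \<subseteq> J' \<Longrightarrow> linked c J' Z"
proof -
  assume "linked c J Z" and J: "J \<subseteq> J'"
  then obtain P where
    P: "\<And>k. k < M \<Longrightarrow> graph_path V E (P k) \<and> hd (P k) = f (N + k) \<and> last (P k) = f (c k) \<and>
      set (P k) \<subseteq> f ` J \<union> Z"
    and "\<forall>k<M. \<forall>l<M. k \<noteq> l \<longrightarrow> set (P k) \<inter> set (P l) = {}"
    unfolding linked_def by blast
  moreover have "f ` J \<union> Z \<subseteq> f ` J' \<union> Z" using J by blast
  ultimately show "linked c J' Z"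
    unfolding linked_def by (intro exI[of _ P]) (simp add: subset_trans[OF _ \<open>f ` J \<union> Z \<subseteq> _\<close>])
qed

lemma linked_tips:
  assumes "linked c J Z" "Z \<inter> range f = {}" "k < M"
  shows "c k \<in> J" and "l < M \<Longrightarrow> k \<noteq> l \<Longrightarrow> c k \<noteq> c l"
proof -
  from assms(1) obtain P where
    P: "\<And>k. k < M \<Longrightarrow> graph_path V E (P k) \<and> last (P k) = f (c k) \<and> set (P k) \<subseteq> f ` J \<union> Z"
    "\<And>k l. k < M \<Longrightarrow> l < M \<Longrightarrow> k \<noteq> l \<Longrightarrow> set (P k) \<inter> set (P l) = {}"
    unfolding linked_def by blast
  have tip: "f (c k) \<in> set (P k)" if "k < M" for k
    using P(1)[OF that] last_in_set unfolding graph_path_iff by metis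
  have "f (c k) \<in> f ` J \<union> Z" using tip[OF assms(3)] P(1)[OF assms(3)] by blast
  then have "f (c k) \<in> f ` J" using assms(2) by blast
  then show "c k \<in> J" using inj_f by (simp add: inj_image_mem_iff)
  assume "l < M" "k \<noteq> l"
  then show "c k \<noteq> c l"
    using tip[OF assms(3)] tip[of l] P(2)[OF assms(3), of l] by (metis disjoint_iff)
qed

text \<open>A spiral edge is a jump with empty \<open>Zs\<close>, so this covers both ways of
  extending a path.\<close>

lemma linked_extend:
  assumes lk: "linked c J Z" and Z: "Z \<inter> range f = {}" and k: "k < M"
    and jmp: "jump V E f (c k) u Zs" and u: "u \<notin> J" and Zs: "set Zs \<inter> Z = {}"
  shows "linked (c(k := u)) (insert u J) (Z \<union> set Zs)"
proof -
  from lk obtain P where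
    P: "\<And>k. k < M \<Longrightarrow> graph_path V E (P k) \<and> hd (P k) = f (N + k) \<and> last (P k) = f (c k) \<and>
      set (P k) \<subseteq> f ` J \<union> Z"
    and dj: "\<And>k l. k < M \<Longrightarrow> l < M \<Longrightarrow> k \<noteq> l \<Longrightarrow> set (P k) \<inter> set (P l) = {}"
    unfolding linked_def by blast
  define P' where "P' = P(k := P k @ Zs @ [f u])"
  have "set Zs \<inter> range f = {}" using jmp by (auto simp: jump_def)
  then have new: "set (Zs @ [f u]) \<inter> (f ` J \<union> Z) = {}"
    using Z Zs u inj_f by (auto dest: injD)
  have dj': "set (P l) \<inter> set (Zs @ [f u]) = {}" if "l < M" for l using P[OF that] new by blast
  have "graph_path V E (P k @ Zs @ [f u])"
  proof -
    have "distinct (Zs @ [f u])" using jmp by (auto simp: jump_def)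
    moreover have "set (Zs @ [f u]) \<subseteq> V" using jmp range_f by (auto simp: jump_def)
    moreover have "successively E (P k @ Zs @ [f u])"
      using P[OF k] jmp unfolding jump_def graph_path_iff
      by (auto simp: successively_append_iff successively_Cons)
    ultimately show ?thesis using P[OF k] dj'[OF k] unfolding graph_path_iff by auto
  qed
  then have "graph_path V E (P' l) \<and> hd (P' l) = f (N + l) \<and> last (P' l) = f ((c(k := u)) l) \<and>
      set (P' l) \<subseteq> f ` insert u J \<union> (Z \<union> set Zs)" if "l < M" for l
    using P[OF that] unfolding P'_def by (auto simp: graph_path_iff)
  moreover have "set (P' l) \<inter> set (P' l') = {}" if "l < M" "l' < M" "l \<noteq> l'" for l l'
    using dj[OF that] dj'[OF that(1)] dj'[OF that(2)] that unfolding P'_def by auto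
  ultimately show ?thesis unfolding linked_def by blast
qed

text \<open>Up to time \<open>n\<close> the paths use indices below \<open>n\<close>. The tips of the paths in \<open>I\<close> lie in the last
  turn before \<open>n\<close>, in the residue classes given by \<open>a\<close>; the other paths wait at the tips given by
  \<open>d\<close>.\<close>

definition placed :: "nat \<Rightarrow> (nat \<Rightarrow> nat) \<Rightarrow> nat set \<Rightarrow> (nat \<Rightarrow> nat) \<Rightarrow> 'a set \<Rightarrow> bool" where
  "placed n a I d Z \<longleftrightarrow> I \<subseteq> {..<M} \<and> 2 * N \<le> n \<and> Z \<inter> range f = {} \<and>
     (\<exists>c. linked c ({N..<n} \<union> d ` ({..<M} - I)) Z \<and>
        (\<forall>k\<in>I. n \<le> c k + N \<and> c k < n \<and> c k mod N = a k mod N) \<and>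
        (\<forall>k\<in>{..<M} - I. c k = d k))"

lemma placed_cong:
  assumes "placed n a I d Z" "\<And>k. k \<in> I \<Longrightarrow> a k mod N = b k mod N"
  shows "placed n b I d Z"
proof -
  from assms(1) obtain c where "linked c ({N..<n} \<union> d ` ({..<M} - I)) Z"
    "\<And>k. k \<in> I \<Longrightarrow> n \<le> c k + N \<and> c k < n \<and> c k mod N = a k mod N"
    "\<forall>k\<in>{..<M} - I. c k = d k"
    unfolding placed_def by blast
  moreover from this have "\<forall>k\<in>I. n \<le> c k + N \<and> c k < n \<and> c k mod N = b k mod N"
    using assms(2) by simp
  ultimately show ?thesis using assms(1) unfolding placed_def by blast
qed

lemma placed_all_cong:
  assumes "placed n a {..<M} d Z" "\<And>k. k < M \<Longrightarrow> a k mod N = b k mod N"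
  shows "placed n b {..<M} d' Z"
proof -
  have "placed n b {..<M} d Z" using placed_cong[OF assms(1)] assms(2) by simp
  then show ?thesis unfolding placed_def by simp
qed

text \<open>Parks path \<open>k\<close> at its landing vertex \<open>u\<close>, possibly many turns
  ahead of the clock; \<open>d\<close> records \<open>u\<close> as used.\<close>

lemma placed_move:
  assumes pl: "placed n a I d Z" and k: "k \<in> I" "a k mod N = p mod N" "n \<le> p + N" "p < n"
    and jmp: "jump V E f p u Zs" "set Zs \<inter> Z = {}" and u: "n \<le> u" "u \<notin> d ` ({..<M} - I)"
  shows "placed n a (I - {k}) (d(k := u)) (Z \<union> set Zs)"
proof -
  from pl obtain c where I: "I \<subseteq> {..<M}" and n: "2 * N \<le> n" and Z: "Z \<inter> range f = {}"
    and lk: "linked c ({N..<n} \<union> d ` ({..<M} - I)) Z"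
    and cI: "\<And>k. k \<in> I \<Longrightarrow> n \<le> c k + N \<and> c k < n \<and> c k mod N = a k mod N"
    and cd: "\<And>k. k \<in> {..<M} - I \<Longrightarrow> c k = d k"
    unfolding placed_def by blast
  have "c k = p"
    by (rule mod_eq_close[of _ N]) (use cI[OF k(1)] k in auto)
  have kM: "k < M" using k I by auto
  have "linked (c(k := u)) (insert u ({N..<n} \<union> d ` ({..<M} - I))) (Z \<union> set Zs)"
    using linked_extend[OF lk Z kM _ _ jmp(2), of u] jmp(1) u \<open>c k = p\<close> by auto
  moreover have "insert u ({N..<n} \<union> d ` ({..<M} - I)) =
      {N..<n} \<union> (d(k := u)) ` ({..<M} - (I - {k}))"
  proof -
    have "{..<M} - (I - {k}) = insert k ({..<M} - I)" using kM by blast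
    moreover have "(d(k := u)) ` ({..<M} - I) = d ` ({..<M} - I)"
      using k(1) by (intro image_cong) auto
    ultimately show ?thesis by auto
  qed
  ultimately have "linked (c(k := u)) ({N..<n} \<union> (d(k := u)) ` ({..<M} - (I - {k}))) (Z \<union> set Zs)"
    by simp
  moreover have "(Z \<union> set Zs) \<inter> range f = {}" using Z jmp by (auto simp: jump_def)
  moreover have "\<forall>l\<in>I - {k}. n \<le> (c(k := u)) l + N \<and> (c(k := u)) l < n \<and>
      (c(k := u)) l mod N = a l mod N"
    using cI by auto
  moreover have "\<forall>l\<in>{..<M} - (I - {k}). (c(k := u)) l = (d(k := u)) l" using cd by auto
  ultimately show ?thesis using I n unfolding placed_def by blast
qed

text \<open>When the last turn before \<open>n\<close> contains the parked tips, the waiting paths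
  rejoin the others in the classes where they landed.\<close>

lemma placed_unpark:
  assumes pl: "placed n a I d Z" and d: "\<And>k. k < M \<Longrightarrow> k \<notin> I \<Longrightarrow> n \<le> d k + N \<and> d k < n"
    and b: "\<And>k. k < M \<Longrightarrow> b k mod N = (if k \<in> I then a k else d k) mod N"
  shows "placed n b {..<M} d' Z"
proof -
  from pl obtain c where I: "I \<subseteq> {..<M}" and n: "2 * N \<le> n" and Z: "Z \<inter> range f = {}"
    and lk: "linked c ({N..<n} \<union> d ` ({..<M} - I)) Z"
    and cI: "\<And>k. k \<in> I \<Longrightarrow> n \<le> c k + N \<and> c k < n \<and> c k mod N = a k mod N"
    and cd: "\<And>k. k \<in> {..<M} - I \<Longrightarrow> c k = d k"
    unfolding placed_def by blast
  have "N \<le> d k" if "k < M" "k \<notin> I" for k using d[OF that] n by linarith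
  then have "d ` ({..<M} - I) \<subseteq> {N..<n}" using d by auto
  then have "linked c {N..<n} Z" using linked_mono[OF lk] by blast
  moreover have "n \<le> c k + N \<and> c k < n \<and> c k mod N = b k mod N" if "k < M" for k
    using b[OF that] d[OF that] cI cd that by (cases "k \<in> I") auto
  ultimately show ?thesis using n Z unfolding placed_def by auto
qed

text \<open>A tip leaves the window only if it sits at \<open>n - N\<close>; it then takes the
  radial edge to \<open>n\<close> and keeps its class. All other tips stand still. By
  \<open>free\<close>, the moving path does not run into a parked one.\<close>

lemma placed_step:
  assumes pl: "placed n a I d Z"
    and free: "\<And>k. n \<in> d ` ({..<M} - I) \<Longrightarrow> k \<in> I \<Longrightarrow> a k mod N \<noteq> n mod N"
  shows "placed (n + 1) a I d Z"
proof -
  from pl obtain c where I: "I \<subseteq> {..<M}" and n: "2 * N \<le> n" and Z: "Z \<inter> range f = {}"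
    and lk: "linked c ({N..<n} \<union> d ` ({..<M} - I)) Z"
    and cI: "\<And>k. k \<in> I \<Longrightarrow> n \<le> c k + N \<and> c k < n \<and> c k mod N = a k mod N"
    and cd: "\<And>k. k \<in> {..<M} - I \<Longrightarrow> c k = d k"
    unfolding placed_def by blast
  show ?thesis
  proof (cases "\<exists>k\<in>I. c k + N = n")
    case True
    then obtain k where k: "k \<in> I" "c k + N = n" by blast
    then have kM: "k < M" using I by auto
    have "a k mod N = n mod N" using cI[OF k(1)] k(2) by (metis mod_add_self2)
    then have nd: "n \<notin> d ` ({..<M} - I)" using free k(1) by blast
    have "spiral_adj t N X (c k) n"
      using k(2) n N_big by (auto simp: spiral_adj_less spiral_up_far)
    then have "jump V E f (c k) n []" by (intro jump_edge hom_f)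
    then have "linked (c(k := n)) (insert n ({N..<n} \<union> d ` ({..<M} - I))) Z"
      using linked_extend[OF lk Z kM, of n "[]"] nd by simp
    moreover have "insert n ({N..<n} \<union> d ` ({..<M} - I)) = {N..<n + 1} \<union> d ` ({..<M} - I)"
      using n by auto
    moreover have "n + 1 \<le> c l + N" if "l \<in> I" "l \<noteq> k" for l
    proof -
      have "c l \<noteq> c k" using linked_tips(2)[OF lk Z _ kM that(2)] that I by auto
      then show ?thesis using cI[OF that(1)] k(2) by auto
    qed
    then have "\<forall>l\<in>I. n + 1 \<le> (c(k := n)) l + N \<and> (c(k := n)) l < n + 1 \<and>
        (c(k := n)) l mod N = a l mod N"
      using cI \<open>a k mod N = n mod N\<close> N_big by (auto intro: less_SucI)
    moreover have "\<forall>l\<in>{..<M} - I. (c(k := n)) l = d l" using cd k by auto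
    ultimately show ?thesis using I n Z unfolding placed_def by (auto intro!: exI[of _ "c(k := n)"])
  next
    case False
    have "linked c ({N..<n + 1} \<union> d ` ({..<M} - I)) Z" by (rule linked_mono[OF lk]) auto
    moreover have "\<forall>l\<in>I. n + 1 \<le> c l + N \<and> c l < n + 1 \<and> c l mod N = a l mod N"
    proof
      fix l assume "l \<in> I"
      then show "n + 1 \<le> c l + N \<and> c l < n + 1 \<and> c l mod N = a l mod N"
        using cI[of l] False by fastforce
    qed
    ultimately show ?thesis using I n Z cd unfolding placed_def by (auto intro!: exI[of _ c])
  qed
qed

lemma placed_wait:
  assumes "placed n a I d Z" "n \<le> m"
    and "\<And>i k. n \<le> i \<Longrightarrow> i < m \<Longrightarrow> i \<in> d ` ({..<M} - I) \<Longrightarrow> k \<in> I \<Longrightarrow> a k mod N \<noteq> i mod N"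
  shows "placed m a I d Z"
  using assms(2,3)
proof (induction m rule: dec_induct)
  case base then show ?case using assms(1) by simp
next
  case (step m)
  then have "placed m a I d Z" by simp
  then show ?case using placed_step[of m a I d Z] step.prems[of m] step.hyps by simp
qed

lemma placed_wait_all: "placed n a {..<M} d Z \<Longrightarrow> n \<le> m \<Longrightarrow> placed m a {..<M} d Z"
  by (rule placed_wait) auto

text \<open>A tip at \<open>n - 1\<close> follows the spiral edge to \<open>n\<close> and so moves
  up by one class. As no active tip has the class of \<open>n\<close>, none is forced to move to
  \<open>n\<close> at this time.\<close>

lemma placed_slide:
  assumes pl: "placed n a I d Z" and k: "k \<in> I" "a k mod N = (n - 1) mod N"
    and nd: "n \<notin> d ` ({..<M} - I)" and free: "\<And>l. l \<in> I \<Longrightarrow> a l mod N \<noteq> n mod N"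
  shows "placed (n + 1) (a(k := a k + 1)) I d Z"
proof -
  from pl obtain c where I: "I \<subseteq> {..<M}" and n: "2 * N \<le> n" and Z: "Z \<inter> range f = {}"
    and lk: "linked c ({N..<n} \<union> d ` ({..<M} - I)) Z"
    and cI: "\<And>k. k \<in> I \<Longrightarrow> n \<le> c k + N \<and> c k < n \<and> c k mod N = a k mod N"
    and cd: "\<And>k. k \<in> {..<M} - I \<Longrightarrow> c k = d k"
    unfolding placed_def by blast
  have kM: "k < M" using k I by auto
  have "c k = n - 1"
    by (rule mod_eq_close[of _ N]) (use cI[OF k(1)] k(2) n N_big in auto)
  then have "spiral_adj t N X (c k) n"
    using n N_big by (auto simp: spiral_adj_less spiral_up_far)
  then have "jump V E f (c k) n []" by (intro jump_edge hom_f)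
  then have "linked (c(k := n)) (insert n ({N..<n} \<union> d ` ({..<M} - I))) Z"
    using linked_extend[OF lk Z kM, of n "[]"] nd by simp
  moreover have "insert n ({N..<n} \<union> d ` ({..<M} - I)) = {N..<n + 1} \<union> d ` ({..<M} - I)"
    using n by auto
  moreover have "n + 1 \<le> c l + N" if "l \<in> I" for l
  proof -
    have "c l + N \<noteq> n" using free[OF that] cI[OF that] by (metis mod_add_self2)
    then show ?thesis using cI[OF that] by auto
  qed
  moreover have "n mod N = (a k + 1) mod N"
    using mod_add_cong[OF k(2) refl, of 1] n N_big by simp
  ultimately have "\<forall>l\<in>I. n + 1 \<le> (c(k := n)) l + N \<and> (c(k := n)) l < n + 1 \<and>
      (c(k := n)) l mod N = (a(k := a k + 1)) l mod N"
    using cI N_big by (auto intro: less_SucI)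
  moreover have "\<forall>l\<in>{..<M} - I. (c(k := n)) l = d l" using cd k by auto
  ultimately show ?thesis
    using I n Z \<open>linked (c(k := n)) _ Z\<close> \<open>insert n _ = _\<close>
    unfolding placed_def by (auto intro!: exI[of _ "c(k := n)"])
qed

end

section \<open>Cyclic orders of the paths and their realisations\<close>

lemma exists_map_eq:
  assumes "distinct xs" "length ys = length xs" shows "\<exists>b. map b xs = ys"
proof -
  have "map (the \<circ> map_of (zip xs ys)) xs = ys"
    using assms by (intro nth_equalityI) (simp_all add: map_of_zip_nth)
  then show ?thesis by blast
qed

lemma sorted_wrt_map_iff:
  fixes a b :: "'b \<Rightarrow> nat"
  assumes "sorted_wrt (<) (map a xs)" "sorted_wrt (<) (map b xs)" "k \<in> set xs" "l \<in> set xs"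
  shows "a k < a l \<longleftrightarrow> b k < b l"
  using assms by (induction xs) auto

context jumping_spiral begin

text \<open>A cyclic order \<open>xs\<close> of the path labels, realised by residue classes: the lifts \<open>a\<close> of the
  classes increase along \<open>xs\<close> and span less than one turn.\<close>

definition cyclic_order :: "nat list \<Rightarrow> (nat \<Rightarrow> nat) \<Rightarrow> bool" where
  "cyclic_order xs a \<longleftrightarrow> distinct xs \<and> set xs = {..<M} \<and> sorted_wrt (<) (map a xs) \<and>
     (\<forall>k\<in>set xs. \<forall>l\<in>set xs. a l < a k + N)"

lemma cyclic_order_inj:
  assumes "cyclic_order xs a" "k < M" "l < M" "k \<noteq> l" shows "a k mod N \<noteq> a l mod N"
proof
  assume "a k mod N = a l mod N"
  then have "a k = a l"
    by (rule mod_eq_close) (use assms in \<open>auto simp: cyclic_order_def\<close>)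
  moreover have "inj_on a {..<M}"
    using assms(1) unfolding cyclic_order_def strict_sorted_iff distinct_map by metis
  ultimately show False using assms by (auto dest: inj_onD)
qed

lemma placed_shift_one:
  assumes pl: "placed n a {..<M} d Z" and k: "k < M"
    and free: "\<And>l. l < M \<Longrightarrow> a l mod N \<noteq> (a k + 1) mod N"
  shows "\<exists>n'\<ge>n. placed n' (a(k := a k + 1)) {..<M} d Z"
proof -
  \<comment> \<open>A time not before \<open>n\<close> whose class is the successor of that of
    \<open>k\<close>.\<close>
  define m where "m = a k + 1 + N * n"
  have m: "n \<le> m" "m mod N = (a k + 1) mod N" "(m - 1) mod N = a k mod N"
    using N_big by (auto simp: m_def intro: order_trans[of n "N * n"])
  have "placed m a {..<M} d Z" using placed_wait_all[OF pl m(1)] .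
  then have "placed (m + 1) (a(k := a k + 1)) {..<M} d Z"
    by (rule placed_slide) (use k m free in auto)
  then show ?thesis using m(1) by (intro exI[of _ "m + 1"]) auto
qed

text \<open>If every path below its target were blocked by its successor, then these paths would occupy
  all \<open>N\<close> classes.\<close>

lemma exists_unblocked:
  assumes a: "cyclic_order xs a" and b: "cyclic_order xs b" and le: "\<And>k. k < M \<Longrightarrow> a k \<le> b k"
    and ex: "\<exists>k<M. a k < b k"
  shows "\<exists>k<M. a k < b k \<and> (\<forall>l<M. a l mod N \<noteq> (a k + 1) mod N)"
proof (rule ccontr)
  assume neg: "\<not> ?thesis"
  define D where "D = {k. k < M \<and> a k < b k}"
  have span: "a l < a k + N" "b l < b k + N" if "k < M" "l < M" for k l
    using a b that unfolding cyclic_order_def by auto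
  have same: "a k < a l \<longleftrightarrow> b k < b l" if "k < M" "l < M" for k l
    using a b that sorted_wrt_map_iff[of a xs b k l] unfolding cyclic_order_def by auto
  have step: "\<exists>l\<in>D. a l mod N = (a k + 1) mod N" if kD: "k \<in> D" for k
  proof -
    have k: "k < M" "a k < b k" using kD by (auto simp: D_def)
    with neg obtain l where l: "l < M" "a l mod N = (a k + 1) mod N" by blast
    \<comment> \<open>The blocking path may lie across the cut of the cyclic order, with its lift
      one turn lower; the span of \<open>b\<close> shows that it is below its target even
      then.\<close>
    have "a l = a k + 1 \<or> a l + N = a k + 1"
    proof (cases "a l + N = a k + 1")
      case False
      then have "a k + 1 < a l + N" using span[OF l(1) k(1)] by simp
      then show ?thesis using mod_eq_close[OF l(2)] span[OF k(1) l(1)] by simp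
    qed simp
    then have "a l < b l"
    proof
      assume "a l = a k + 1"
      then have "b k < b l" using same[OF k(1) l(1)] by simp
      then show ?thesis using \<open>a l = a k + 1\<close> k(2) by simp
    next
      assume "a l + N = a k + 1"
      then show ?thesis using k(2) span(2)[OF l(1) k(1)] by simp
    qed
    then show ?thesis using l by (auto simp: D_def)
  qed
  define C where "C = (\<lambda>k. a k mod N) ` D"
  from ex obtain k0 where k0: "k0 \<in> D" by (auto simp: D_def)
  have C: "(a k0 + i) mod N \<in> C" for i
  proof (induction i)
    case 0 then show ?case using k0 by (auto simp: C_def)
  next
    case (Suc i)
    then obtain k where k: "k \<in> D" "(a k0 + i) mod N = a k mod N" by (auto simp: C_def)
    then obtain l where l: "l \<in> D" "a l mod N = (a k + 1) mod N" using step by blast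
    have "(a k0 + Suc i) mod N = (a k + 1) mod N"
      using mod_add_cong[OF k(2) refl, of 1] by simp
    then show ?case using l unfolding C_def by (metis imageI)
  qed
  have "{..<N} \<subseteq> C"
  proof
    fix r assume "r \<in> {..<N}"
    have "1 * a k0 \<le> N * a k0" using N_big by (intro mult_right_mono) auto
    then obtain i where "a k0 + i = r + N * a k0" by (metis le_add_diff_inverse mult_1 trans_le_add2)
    then have "(a k0 + i) mod N = r" using \<open>r \<in> {..<N}\<close> by simp
    then show "r \<in> C" using C by metis
  qed
  have "D \<subseteq> {..<M}" by (auto simp: D_def)
  then have "finite D" "card D \<le> M"
    using finite_subset card_mono[of "{..<M}" D] by auto
  then have "N \<le> M"
    using card_mono[OF _ \<open>{..<N} \<subseteq> C\<close>] card_image_le[of D "\<lambda>k. a k mod N"] unfolding C_def by simp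
  then show False using N_big by simp
qed

text \<open>The total gap to \<open>b\<close> shrinks when an unblocked path slides up one class.
  Being unblocked, it hits neither the next lift nor, one turn up, the least one, so the cyclic
  order survives.\<close>

lemma placed_raise:
  assumes "placed n a {..<M} d Z" "cyclic_order xs a" "cyclic_order xs b" "\<And>k. k < M \<Longrightarrow> a k \<le> b k"
  shows "\<exists>n'\<ge>n. placed n' b {..<M} d Z"
  using assms
proof (induction "\<Sum>k<M. b k - a k" arbitrary: a n rule: less_induct)
  case less
  note span = less.prems(2)[unfolded cyclic_order_def]
  show ?case
  proof (cases "\<exists>k<M. a k < b k")
    case False
    then have "a k mod N = b k mod N" if "k < M" for k
      using less.prems(4)[OF that] False that by (metis le_neq_implies_less)
    then show ?thesis using placed_cong[OF less.prems(1)] by auto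
  next
    case True
    then obtain k where k: "k < M" "a k < b k" and free: "\<And>l. l < M \<Longrightarrow> a l mod N \<noteq> (a k + 1) mod N"
      using exists_unblocked[OF less.prems(2,3,4)] by blast
    define a' where "a' = a(k := a k + 1)"
    obtain n1 where n1: "n \<le> n1" "placed n1 a' {..<M} d Z"
      using placed_shift_one[OF less.prems(1) k(1) free] unfolding a'_def by blast
    have le': "a' l \<le> b l" if "l < M" for l using less.prems(4)[OF that] k by (auto simp: a'_def)
    have "(\<Sum>l<M. b l - a' l) < (\<Sum>l<M. b l - a l)"
    proof (rule sum_strict_mono_ex1)
      show "\<forall>l\<in>{..<M}. b l - a' l \<le> b l - a l" by (auto simp: a'_def)
      show "\<exists>l\<in>{..<M}. b l - a' l < b l - a l" using k by (auto simp: a'_def)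
    qed simp
    moreover have "cyclic_order xs a'"
    proof -
      have "sorted_wrt (\<lambda>x y. a' x < a' y) xs"
      proof (rule sorted_wrt_mono_rel)
        show "sorted_wrt (\<lambda>x y. a x < a y) xs" using span by (simp add: sorted_wrt_map)
        fix x y assume xy: "x \<in> set xs" "y \<in> set xs" "a x < a y"
        then have "a y \<noteq> a k + 1" using free[of y] span by auto
        then show "a' x < a' y" using xy by (auto simp: a'_def)
      qed
      moreover have "a' l < a' m + N" if "l \<in> set xs" "m \<in> set xs" for l m
      proof -
        have "m < M" using span that by auto
        then have "a m mod N \<noteq> (a k + 1) mod N" by (rule free)
        then have "a m + N \<noteq> a k + 1" by (metis mod_add_self2)
        moreover have "a l < a m + N" using span that by blast
        ultimately show ?thesis using N_big by (auto simp: a'_def)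
      qed
      ultimately show ?thesis using span unfolding cyclic_order_def by (simp add: sorted_wrt_map)
    qed
    ultimately obtain n' where "n1 \<le> n'" "placed n' b {..<M} d Z"
      using less.hyps[OF _ n1(2) _ less.prems(3) le'] by blast
    then show ?thesis using n1 by (meson order_trans)
  qed
qed

text \<open>Slides only raise lifts; adding a multiple of \<open>N\<close> to \<open>b\<close> puts
  it above \<open>a\<close> without changing classes.\<close>

lemma placed_rearrange:
  assumes "placed n a {..<M} d Z" "cyclic_order xs a" "cyclic_order xs b"
  shows "\<exists>n'\<ge>n. placed n' b {..<M} d Z"
proof -
  define b' where "b' = (\<lambda>k. b k + (\<Sum>l<M. a l) * N)"
  have "cyclic_order xs b'"
    using assms(3) unfolding cyclic_order_def by (auto simp: b'_def sorted_wrt_map)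
  moreover have "a k \<le> b' k" if "k < M" for k
  proof -
    have "a k \<le> (\<Sum>l<M. a l)" using that by (intro member_le_sum) auto
    also have "\<dots> \<le> (\<Sum>l<M. a l) * N" using N_big by simp
    finally show ?thesis by (simp add: b'_def)
  qed
  ultimately obtain n' where "n \<le> n'" "placed n' b' {..<M} d Z"
    using placed_raise[OF assms(1,2)] by blast
  moreover from this have "placed n' b {..<M} d Z"
    by (elim placed_cong) (simp add: b'_def)
  ultimately show ?thesis by blast
qed

text \<open>Finiteness of \<open>Z\<close> lets later jumps avoid it. All paths are active, and 0 is
  the default of the parking function.\<close>

definition reachable_order :: "nat list \<Rightarrow> bool" where
  "reachable_order xs \<longleftrightarrow>
     (\<exists>n a Z. finite Z \<and> cyclic_order xs a \<and> placed n a {..<M} (\<lambda>_. 0) Z)"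

lemma reachable_orderI:
  "finite Z \<Longrightarrow> cyclic_order xs a \<Longrightarrow> placed n a {..<M} d Z \<Longrightarrow> reachable_order xs"
  unfolding reachable_order_def using placed_all_cong by blast

lemma reachable_orderE:
  assumes "reachable_order xs" "cyclic_order xs b"
  obtains n Z where "finite Z" "Z \<inter> range f = {}" "2 * N \<le> n" "placed n b {..<M} (\<lambda>_. 0) Z"
proof -
  from assms(1) obtain n a Z where "finite Z" "cyclic_order xs a" "placed n a {..<M} (\<lambda>_. 0) Z"
    unfolding reachable_order_def by blast
  then obtain n' where "placed n' b {..<M} (\<lambda>_. 0) Z" using placed_rearrange assms(2) by blast
  then show ?thesis using that[of Z n'] \<open>finite Z\<close> unfolding placed_def by blast
qed

text \<open>A full turn added to the least lift makes it the greatest and leaves its class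
  unchanged; no path has to move.\<close>

lemma reachable_order_rotate:
  assumes "reachable_order (x # xs)" shows "reachable_order (xs @ [x])"
proof -
  from assms obtain n a Z where *: "finite Z" "cyclic_order (x # xs) a"
    "placed n a {..<M} (\<lambda>_. 0) Z"
    unfolding reachable_order_def by blast
  define b where "b = a(x := a x + N)"
  have xs: "x \<notin> set xs" and less: "\<And>k. k \<in> set xs \<Longrightarrow> a x < a k"
    and span: "\<And>k l. k \<in> set (x # xs) \<Longrightarrow> l \<in> set (x # xs) \<Longrightarrow> a l < a k + N"
    using *(2) unfolding cyclic_order_def by auto
  have b: "b x = a x + N" "\<And>k. k \<in> set xs \<Longrightarrow> b k = a k" using xs by (auto simp: b_def)
  have "cyclic_order (xs @ [x]) b"
    unfolding cyclic_order_def
  proof (intro conjI ballI)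
    show "distinct (xs @ [x])" "set (xs @ [x]) = {..<M}"
      using *(2) unfolding cyclic_order_def by auto
    have "sorted_wrt (<) (map a xs)" using *(2) unfolding cyclic_order_def by simp
    also have "map a xs = map b xs" using b by simp
    finally have "sorted_wrt (<) (map b xs)" .
    moreover have "\<forall>k\<in>set xs. b k < b x" using b span[of x] by simp
    ultimately show "sorted_wrt (<) (map b (xs @ [x]))" by (simp add: sorted_wrt_append)
    fix k l assume "k \<in> set (xs @ [x])" "l \<in> set (xs @ [x])"
    then show "b l < b k + N"
      using b span[of k l] less N_big by (cases "k = x"; cases "l = x") (auto intro: trans_less_add1)
  qed
  moreover have "placed n b {..<M} (\<lambda>_. 0) Z"
    by (rule placed_cong[OF *(3)]) (simp add: b_def)
  ultimately show ?thesis using *(1) reachable_orderI by blast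
qed

end

section \<open>Effect of jumps on the cyclic order\<close>

context jumping_spiral begin

text \<open>The threshold separates two uses of a jump into the same or a neighbouring class. Below
  \<open>2 * N - 1\<close> its length is \<open>N - 1\<close> or \<open>N + 1\<close>, since 1 and
  \<open>N\<close> belong to edges; from there on, more than a turn lies between \<open>v\<close>
  and \<open>w\<close>.\<close>

definition jump_type :: "nat \<Rightarrow> nat \<Rightarrow> nat \<times> nat \<times> bool" where
  "jump_type v w = (v mod N, (w - v) mod N, w - v < 2 * N - 1)"

text \<open>Pigeonhole over finitely many types: if each type failed for some bound and some finite
  set, the maximal bound and the union of the sets would rule out every jump.\<close>

lemma jumps_of_one_type:
  "\<exists>r d near. \<forall>m Q. finite Q \<longrightarrow> (\<exists>v w Zs. m \<le> v \<and> v < w \<and> \<not> spiral_adj t N X v w \<and>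
      jump V E f v w Zs \<and> set Zs \<inter> Q = {} \<and> jump_type v w = (r, d, near))"
proof (rule ccontr)
  define good where "good m Q \<tau> \<longleftrightarrow> (\<exists>v w Zs. m \<le> v \<and> v < w \<and> \<not> spiral_adj t N X v w \<and>
      jump V E f v w Zs \<and> set Zs \<inter> Q = {} \<and> jump_type v w = \<tau>)" for m Q \<tau>
  assume "\<not> ?thesis"
  then have "\<nexists>r d near. \<forall>m Q. finite Q \<longrightarrow> good m Q (r, d, near)"
    unfolding good_def .
  then have "\<exists>m Q. finite Q \<and> \<not> good m Q \<tau>" for \<tau>
    by (cases \<tau>) blast
  then obtain m Q where mQ: "\<And>\<tau>. finite (Q \<tau>) \<and> \<not> good (m \<tau>) (Q \<tau>) \<tau>" by metis
  define T where "T = {..<N} \<times> {..<N} \<times> (UNIV :: bool set)"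
  have "finite T" by (simp add: T_def)
  then have "finite (\<Union>\<tau>\<in>T. Q \<tau>)" using mQ by blast
  from jumps[OF this, of "Max (m ` T)"] obtain v w Zs where
    j: "Max (m ` T) \<le> v" "v < w" "\<not> spiral_adj t N X v w" "jump V E f v w Zs"
    "set Zs \<inter> (\<Union>\<tau>\<in>T. Q \<tau>) = {}" by blast
  have "jump_type v w \<in> T" using N_big by (auto simp: T_def jump_type_def)
  moreover from this have "m (jump_type v w) \<le> v"
    using j(1) \<open>finite T\<close> by (meson Max_ge finite_imageI imageI order_trans)
  ultimately have "good (m (jump_type v w)) (Q (jump_type v w)) (jump_type v w)"
    using j unfolding good_def by (intro exI[of _ v] exI[of _ w] exI[of _ Zs]) auto
  then show False using mQ by blast
qed

lemma cyclic_order_map: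
  assumes "cyclic_order xs a" "distinct ys" "set ys = {..<M}" "map b ys = map a xs"
  shows "cyclic_order ys b"
proof -
  have "set (map b ys) = set (map a xs)" by (simp only: assms(4))
  then have im: "b ` set ys = a ` set xs" by simp
  have "b l < b k + N" if "k \<in> set ys" "l \<in> set ys" for k l
  proof -
    have "b k \<in> a ` set xs" "b l \<in> a ` set xs" using that by (simp_all flip: im)
    then show ?thesis using assms(1) unfolding cyclic_order_def by auto
  qed
  then show ?thesis using assms unfolding cyclic_order_def by simp
qed

text \<open>At time \<open>v + 1\<close> the window ends with \<open>v\<close>, so path
  \<open>k\<close> has its tip there. It is parked at \<open>w\<close> while the others keep their
  classes, all different from that of \<open>w\<close>.\<close>

lemma placed_jump:
  assumes pl: "placed (v + 1) b {..<M} d Z" and k: "k < M" "b k mod N = v mod N"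
    and jmp: "jump V E f v w Zs" "set Zs \<inter> Z = {}" "v < w"
    and free: "\<And>l. l < M \<Longrightarrow> l \<noteq> k \<Longrightarrow> b l mod N \<noteq> w mod N"
  shows "placed (w + 1) (b(k := w)) {..<M} d' (Z \<union> set Zs)"
proof -
  have "placed (v + 1) b ({..<M} - {k}) (d(k := w)) (Z \<union> set Zs)"
    by (rule placed_move[OF pl _ k(2) _ _ jmp(1,2)]) (use k jmp N_big in auto)
  moreover have "{..<M} - ({..<M} - {k}) = {k}" using k(1) by auto
  ultimately have "placed (w + 1) b ({..<M} - {k}) (d(k := w)) (Z \<union> set Zs)"
    using jmp(3) free by (elim placed_wait) auto
  then show ?thesis by (rule placed_unpark) (use N_big in auto)
qed

text \<open>Whichever jump occurs, it lands in the class of \<open>r + e\<close>, so the new order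
  is known beforehand. That \<open>b'\<close> is a cyclic order also shows the landing class to be
  free.\<close>

lemma reachable_by_jump:
  assumes jt: "\<And>m Q. finite Q \<Longrightarrow> \<exists>v w Zs. m \<le> v \<and> v < w \<and> \<not> spiral_adj t N X v w \<and>
      jump V E f v w Zs \<and> set Zs \<inter> Q = {} \<and> jump_type v w = (r, e, near)"
    and xs: "reachable_order xs" and b: "cyclic_order xs b"
    and k: "k < M" "b k mod N = r mod N" and p: "p mod N = (r + e) mod N"
    and b': "cyclic_order ys (b(k := p))"
  shows "reachable_order ys"
proof -
  obtain n Z where n: "finite Z" "Z \<inter> range f = {}" "placed n b {..<M} (\<lambda>_. 0) Z"
    by (rule reachable_orderE[OF xs b])
  from jt[OF n(1), of n] obtain v w Zs where v: "n \<le> v" "v < w" "jump V E f v w Zs"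
    "set Zs \<inter> Z = {}" "v mod N = r" "(w - v) mod N = e"
    by (auto simp: jump_type_def)
  have "w mod N = (v + (w - v)) mod N" using v(2) by simp
  also have "\<dots> = (r + e) mod N" using v(5,6) by (metis mod_add_eq)
  finally have w: "w mod N = p mod N" using p by simp
  have "r mod N = r" using v(5) by (metis mod_mod_trivial)
  have "placed (v + 1) b {..<M} (\<lambda>_. 0) Z" using placed_wait_all[OF n(3)] v(1) by simp
  then have "placed (w + 1) (b(k := w)) {..<M} (\<lambda>_. 0) (Z \<union> set Zs)"
  proof (rule placed_jump[OF _ k(1) _ v(3,4,2)])
    show "b k mod N = v mod N" using k v(5) \<open>r mod N = r\<close> by simp
    fix l assume "l < M" "l \<noteq> k"
    then show "b l mod N \<noteq> w mod N" using cyclic_order_inj[OF b', of l k] k(1) w by simp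
  qed
  then have "placed (w + 1) (b(k := p)) {..<M} (\<lambda>_. 0) (Z \<union> set Zs)"
    by (rule placed_cong) (simp add: w)
  then show ?thesis using reachable_orderI[OF _ b'] n(1) by blast
qed

text \<open>A pair of edges or jumps along both diagonals of a quadrilateral.\<close>

lemma reachable_by_crossing:
  assumes cr: "\<And>m Q. finite Q \<Longrightarrow> \<exists>u Zs Zs'. m \<le> u \<and> u mod N = r mod N \<and> jump V E f u (u + N + 1) Zs \<and>
      jump V E f (u + 1) (u + N) Zs' \<and> set Zs \<inter> Q = {} \<and> set Zs' \<inter> Q = {} \<and> set Zs \<inter> set Zs' = {}"
    and xs: "reachable_order (x # y # zs)" and b: "cyclic_order (x # y # zs) b"
    and bx: "b x = r" and b_y: "b y = r + 1"
  shows "reachable_order (y # x # zs)"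
proof -
  obtain n Z where n: "finite Z" "Z \<inter> range f = {}" "placed n b {..<M} (\<lambda>_. 0) Z"
    by (rule reachable_orderE[OF xs b])
  from cr[OF n(1), of n] obtain u Zs Zs' where u: "n \<le> u" "u mod N = r mod N"
    "jump V E f u (u + N + 1) Zs" "jump V E f (u + 1) (u + N) Zs'" "set Zs \<inter> Z = {}"
    "set Zs' \<inter> Z = {}" "set Zs \<inter> set Zs' = {}"
    by blast
  have xy: "x < M" "y < M" "x \<noteq> y" using b unfolding cyclic_order_def by auto
  have u1: "(u + 1) mod N = (r + 1) mod N" using u(2) by (rule mod_add_cong) simp
  have un: "(u + N) mod N = r mod N" "(u + N + 1) mod N = (r + 1) mod N"
    using u(2) u1 mod_add_self2[of "u + 1" N] by (simp_all add: ac_simps)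
  \<comment> \<open>Time \<open>u + 2\<close> is the first at which \<open>u\<close> and
    \<open>u + 1\<close> are both available as tips. The two paths land within the next turn and
    rejoin at \<open>u + N + 2\<close>.\<close>
  have "placed (u + 2) b {..<M} (\<lambda>_. 0) Z" using placed_wait_all[OF n(3)] u(1) by simp
  then have 1: "placed (u + 2) b ({..<M} - {x}) ((\<lambda>_. 0)(x := u + N + 1)) (Z \<union> set Zs)"
    by (rule placed_move[OF _ _ _ _ _ u(3,5)]) (use xy bx u N_big in auto)
  have "{..<M} - ({..<M} - {x}) = {x}" using xy by auto
  then have 2: "placed (u + 2) b ({..<M} - {x} - {y}) ((\<lambda>_. 0)(x := u + N + 1, y := u + N))
      (Z \<union> set Zs \<union> set Zs')"
    by (intro placed_move[OF 1 _ _ _ _ u(4)]) (use xy b_y u u1 N_big in auto)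
  have parked: "{..<M} - ({..<M} - {x} - {y}) = {x, y}" using xy by auto
  have free: "b l mod N \<noteq> (u + N + 1) mod N \<and> b l mod N \<noteq> (u + N) mod N"
    if "l < M" "l \<noteq> x" "l \<noteq> y" for l
    unfolding un
    using cyclic_order_inj[OF b that(1) xy(1) that(2)] cyclic_order_inj[OF b that(1) xy(2) that(3)]
    unfolding bx b_y by blast
  have "placed (u + N + 2) b ({..<M} - {x} - {y}) ((\<lambda>_. 0)(x := u + N + 1, y := u + N))
      (Z \<union> set Zs \<union> set Zs')"
  proof (rule placed_wait[OF 2])
    fix i k
    assume i: "i \<in> ((\<lambda>_. 0)(x := u + N + 1, y := u + N)) ` ({..<M} - ({..<M} - {x} - {y}))"
      and k: "k \<in> {..<M} - {x} - {y}"
    have "i = u + N + 1 \<or> i = u + N" using i xy(3) unfolding parked by auto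
    moreover have "k < M" "k \<noteq> x" "k \<noteq> y" using k by auto
    ultimately show "b k mod N \<noteq> i mod N" using free by blast
  qed simp
  then have "placed (u + N + 2) (b(x := r + 1, y := r)) {..<M} (\<lambda>_. 0) (Z \<union> set Zs \<union> set Zs')"
  proof (rule placed_unpark)
    fix k assume k: "k < M"
    show "u + N + 2 \<le> ((\<lambda>_. 0)(x := u + N + 1, y := u + N)) k + N \<and>
        ((\<lambda>_. 0)(x := u + N + 1, y := u + N)) k < u + N + 2" if "k \<notin> {..<M} - {x} - {y}"
    proof -
      have "k = x \<or> k = y" using that k by auto
      then show ?thesis using xy(3) N_big by auto
    qed
    show "(b(x := r + 1, y := r)) k mod N = (if k \<in> {..<M} - {x} - {y} then b k
        else ((\<lambda>_. 0)(x := u + N + 1, y := u + N)) k) mod N"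
      using k xy(3) un by (cases "k = x"; cases "k = y") (simp_all only: fun_upd_apply, auto)
  qed
  moreover have "cyclic_order (y # x # zs) (b(x := r + 1, y := r))"
  proof -
    have "x \<notin> set zs" "y \<notin> set zs" using b unfolding cyclic_order_def by auto
    then have "map (b(x := r + 1, y := r)) (y # x # zs) = map b (x # y # zs)"
      using bx b_y xy by simp
    moreover have "distinct (y # x # zs)" "set (y # x # zs) = {..<M}"
      using b unfolding cyclic_order_def by auto
    ultimately show ?thesis using cyclic_order_map[OF b] by metis
  qed
  ultimately show ?thesis using reachable_orderI n(1) by blast
qed

text \<open>The path of \<open>y\<close> jumps from class \<open>r\<close> to a much later vertex of a class next to \<open>r\<close>; meanwhile
  the path of \<open>x\<close> slides through the class \<open>r\<close>.\<close>

lemma reachable_by_far_jump: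
  assumes jt: "\<And>m Q. finite Q \<Longrightarrow> \<exists>v w Zs. m \<le> v \<and> v < w \<and> \<not> spiral_adj t N X v w \<and>
      jump V E f v w Zs \<and> set Zs \<inter> Q = {} \<and> jump_type v w = (r, e, False)"
    and xs: "reachable_order (x # y # zs)" and b: "cyclic_order (x # y # zs) b"
    and bx: "b x = s" and b_y: "b y = s + 1" and bz: "\<And>l. l \<in> set zs \<Longrightarrow> s + 4 \<le> b l"
    and r: "(s + 1) mod N = r" and p: "p mod N = (r + e) mod N"
    and b': "cyclic_order (y # x # zs) (b(x := s + 3, y := p))"
  shows "reachable_order (y # x # zs)"
proof -
  obtain n Z where n: "finite Z" "Z \<inter> range f = {}" "placed n b {..<M} (\<lambda>_. 0) Z"
    by (rule reachable_orderE[OF xs b])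
  from jt[OF n(1), of n] obtain v w Zs where v: "n \<le> v" "v < w" "jump V E f v w Zs"
    "set Zs \<inter> Z = {}" "v mod N = r" "(w - v) mod N = e" "2 * N - 1 \<le> w - v"
    by (auto simp: jump_type_def)
  have "w mod N = (v + (w - v)) mod N" using v(2) by simp
  also have "\<dots> = (r + e) mod N" using v(5,6) by (metis mod_add_eq)
  finally have w: "w mod N = p mod N" using p by simp
  have xy: "x < M" "y < M" "x \<noteq> y" using b unfolding cyclic_order_def by auto
  have far: "v + N + 3 \<le> w" using v(2,7) N_big by linarith
  have cls: "(v + N + i) mod N = (s + 1 + i) mod N" for i
  proof -
    have "(v + N + i) mod N = (v + i) mod N" using mod_add_self2[of "v + i" N] by (simp add: ac_simps)
    also have "\<dots> = (s + 1 + i) mod N" using v(5) r by (intro mod_add_cong) auto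
    finally show ?thesis .
  qed
  define I where "I = {..<M} - {y}"
  define d where "d = (\<lambda>_. 0 :: nat)(y := w)"
  have dI: "d ` ({..<M} - I) = {w}" using xy by (auto simp: I_def d_def)
  have zs: "l \<in> set zs" if "l \<in> I" "l \<noteq> x" for l
    using that b unfolding cyclic_order_def I_def by auto
  have span: "b l < s + N" if "l \<in> I" for l
    using that b xy(1) bx unfolding cyclic_order_def I_def by force
  have "placed (v + 1) b {..<M} (\<lambda>_. 0) Z" using placed_wait_all[OF n(3)] v(1) by simp
  then have "placed (v + 1) b I d (Z \<union> set Zs)" unfolding I_def d_def
    by (rule placed_move[OF _ _ _ _ _ v(3,4)]) (use xy b_y r v N_big in auto)
  \<comment> \<open>In the current turn \<open>y\<close> has taken the vertex \<open>v\<close> of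
    class \<open>r\<close>; one turn later, at \<open>v + N\<close>, the class is open to
    \<open>x\<close>.\<close>
  then have "placed (v + N) b I d (Z \<union> set Zs)"
    by (rule placed_wait) (use far dI N_big in auto)
  moreover have "b(x := s + 0) = b" using bx by auto
  ultimately have start: "placed (v + N) (b(x := s + 0)) I d (Z \<union> set Zs)" by simp
  \<comment> \<open>Three slides carry \<open>x\<close> from class \<open>s\<close> to
    \<open>s + 3\<close>, past the classes \<open>s\<close>, \<open>s + 1\<close>,
    \<open>s + 2\<close> that \<open>y\<close> lands in when \<open>e\<close> is
    \<open>N - 1\<close>, 0 or 1; the other lifts are at least \<open>s + 4\<close>.\<close>
  have slide: "placed (v + N + i + 1) (b(x := s + (i + 1))) I d (Z \<union> set Zs)"
    if "placed (v + N + i) (b(x := s + i)) I d (Z \<union> set Zs)" "i < 3" for i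
  proof -
    have "placed (v + N + i + 1) ((b(x := s + i))(x := (b(x := s + i)) x + 1)) I d (Z \<union> set Zs)"
    proof (rule placed_slide[OF that(1)])
      show "x \<in> I" using xy by (simp add: I_def)
      show "v + N + i \<notin> d ` ({..<M} - I)" using dI far that(2) by simp
      have "(v + (N - 1 + i)) mod N = (s + 1 + (N - 1 + i)) mod N"
        using v(5) r by (intro mod_add_cong) auto
      moreover have "s + 1 + (N - 1 + i) = s + i + N" "v + (N - 1 + i) = v + N + i - 1"
        using N_big by auto
      ultimately show "(b(x := s + i)) x mod N = (v + N + i - 1) mod N"
        by (simp only: mod_add_self2 fun_upd_same)
      fix l assume l: "l \<in> I"
      show "(b(x := s + i)) l mod N \<noteq> (v + N + i) mod N"
      proof
        assume "(b(x := s + i)) l mod N = (v + N + i) mod N"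
        then have "(b(x := s + i)) l = s + 1 + i"
          unfolding cls
        proof (rule mod_eq_close)
          show "(b(x := s + i)) l < s + 1 + i + N" using span[OF l] by auto
          show "s + 1 + i < (b(x := s + i)) l + N" using bz zs[OF l] that(2) N_big by fastforce
        qed
        then show False using bz[OF zs[OF l]] that(2) by (cases "l = x") auto
      qed
    qed
    then show ?thesis by simp
  qed
  have "i \<le> 3 \<Longrightarrow> placed (v + N + i) (b(x := s + i)) I d (Z \<union> set Zs)" for i
  proof (induction i)
    case (Suc i)
    have "placed (v + N + i + 1) (b(x := s + (i + 1))) I d (Z \<union> set Zs)"
    proof (rule slide)
      show "placed (v + N + i) (b(x := s + i)) I d (Z \<union> set Zs)"
        by (rule Suc.IH) (use Suc.prems in simp)
      show "i < 3" using Suc.prems by simp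
    qed
    then show ?case by (simp only: Suc_eq_plus1 add.assoc)
  next
    case 0
    show ?case using start by (simp only: add_0_right)
  qed
  from this[of 3, OF order_refl] have "placed (v + N + 3) (b(x := s + 3)) I d (Z \<union> set Zs)" .
  then have "placed (w + 1) (b(x := s + 3)) I d (Z \<union> set Zs)"
  proof (rule placed_wait)
    show "v + N + 3 \<le> w + 1" using far by simp
    fix i k assume "i \<in> d ` ({..<M} - I)" "k \<in> I"
    then show "(b(x := s + 3)) k mod N \<noteq> i mod N"
      using cyclic_order_inj[OF b', of k y] xy w dI by (auto simp: I_def)
  qed
  then have "placed (w + 1) (b(x := s + 3, y := p)) {..<M} (\<lambda>_. 0) (Z \<union> set Zs)"
    by (rule placed_unpark) (use w N_big in \<open>auto simp: I_def d_def\<close>)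
  then show ?thesis using reachable_orderI[OF _ b'] n(1) by blast
qed

end

section \<open>Exchanging neighbouring paths\<close>

context jumping_spiral begin

lemma cyclic_order_of_lifts:
  assumes "distinct xs" "set xs = {..<M}" "map b xs = ys" "sorted_wrt (<) ys"
    "\<forall>p\<in>set ys. \<forall>q\<in>set ys. q < p + N"
  shows "cyclic_order xs b"
proof -
  have "set ys = b ` set xs" using assms(3) by auto
  then show ?thesis using assms unfolding cyclic_order_def by simp
qed

text \<open>The pair is first put into adjacent classes next to the starting class of the jumps, and
  all other paths are packed out of the way, so that a jump can affect only the order of the
  pair.\<close>

lemma reachable_order_swap:
  assumes "reachable_order (x # y # zs)" shows "reachable_order (y # x # zs)"
proof -
  have co: "distinct (x # y # zs)" "set (x # y # zs) = {..<M}"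
    using assms unfolding reachable_order_def cyclic_order_def by auto
  then have co': "distinct (y # x # zs)" "set (y # x # zs) = {..<M}" by auto
  have "length (x # y # zs) = M" using co distinct_card by fastforce
  then have len: "length zs + 2 = M" by simp
  have xy: "x < M" "y < M" "x \<noteq> y" "x \<notin> set zs" "y \<notin> set zs" using co by auto
  \<comment> \<open>The \<open>M - 2\<close> other paths get consecutive lifts from \<open>k\<close>
    on; the last one, \<open>k + M - 3\<close>, has to stay below \<open>p + N\<close>.\<close>
  have lift: "\<exists>b. b x = p \<and> b y = q \<and> map b zs = [k..<k + length zs] \<and> cyclic_order (x # y # zs) b"
    if "p < q" "q < k" "k + M < p + N + 3" for p q k
  proof -
    have "length (p # q # [k..<k + length zs]) = length (x # y # zs)" by simp
    from exists_map_eq[OF co(1) this] obtain b where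
      b: "map b (x # y # zs) = p # q # [k..<k + length zs]" by (rule exE)
    have "cyclic_order (x # y # zs) b"
      by (rule cyclic_order_of_lifts[OF co b]) (use that len in auto)
    then show ?thesis using b by auto
  qed
  have lift': "cyclic_order (y # x # zs) c"
    if "c y < c x" "c x < k" "k + M < c y + N + 3" "map c zs = [k..<k + length zs]" for c k
  proof (rule cyclic_order_of_lifts[OF co'])
    show "map c (y # x # zs) = c y # c x # [k..<k + length zs]" using that(4) by simp
  qed (use that len in auto)
  obtain r e near where jt: "\<And>m Q. finite Q \<Longrightarrow> \<exists>v w Zs. m \<le> v \<and> v < w \<and> \<not> spiral_adj t N X v w \<and>
      jump V E f v w Zs \<and> set Zs \<inter> Q = {} \<and> jump_type v w = (r, e, near)"
    using jumps_of_one_type by blast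
  from jt[of "{}" N] obtain v0 w0 where v0: "N \<le> v0" "v0 < w0" "\<not> spiral_adj t N X v0 w0"
    "jump_type v0 w0 = (r, e, near)" by blast
  have re: "r < N" "e < N" using v0(4) N_big by (auto simp: jump_type_def)
  have keep: "map (b(x := p)) zs = map b zs" "map (b(y := p)) zs = map b zs" for b :: "nat \<Rightarrow> nat" and p
    using xy by auto
  \<comment> \<open>If the others fit between \<open>r + e\<close> and the end of the turn,
    \<open>x\<close> jumps from \<open>r\<close> forward over \<open>y\<close>. If not,
    \<open>N \<ge> 2 * M + 10\<close> leaves room for them between \<open>r\<close> and
    \<open>r + e\<close>, and \<open>y\<close> jumps from \<open>r\<close> backward over
    \<open>x\<close>. The offsets -1, 0 and 1 are treated apart.\<close>
  consider (right) "2 \<le> e" "e + M \<le> N + 1" | (left) "e \<le> N - 2" "N + 1 < e + M"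
    | (far) "e = 0 \<or> e = 1 \<or> e = N - 1" "\<not> near" | (near) "e = 0 \<or> e = 1 \<or> e = N - 1" "near"
    using re by linarith
  then show ?thesis
  proof cases
    case right
    obtain b where b: "b x = r" "b y = r + 1" "map b zs = [r + e + 1..<r + e + 1 + length zs]"
      "cyclic_order (x # y # zs) b"
      using lift[of r "r + 1" "r + e + 1"] right by auto
    have "cyclic_order (y # x # zs) (b(x := r + e))"
      by (rule lift'[of _ "r + e + 1"]) (use b xy right in \<open>auto simp: keep\<close>)
    then show ?thesis
      using reachable_by_jump[OF jt assms b(4) xy(1), of "r + e" "y # x # zs"] b by simp
  next
    case left
    obtain b where b: "b x = r + N - 1" "b y = r + N"
      "map b zs = [r + N + 1..<r + N + 1 + length zs]" "cyclic_order (x # y # zs) b"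
      using lift[of "r + N - 1" "r + N" "r + N + 1"] N_big by auto
    have "cyclic_order (y # x # zs) (b(y := r + e))"
      by (rule lift'[of _ "r + N + 1"]) (use b xy left N_big in \<open>auto simp: keep\<close>)
    then show ?thesis
      using reachable_by_jump[OF jt assms b(4) xy(2), of "r + e" "y # x # zs"] b by simp
  next
    case far
    define s where "s = r + N - 1"
    \<comment> \<open>The lift of the landing class among \<open>s\<close>, \<open>s + 1\<close>,
      \<open>s + 2\<close>; here \<open>s + 1\<close> is a lift of \<open>r\<close>.\<close>
    define p where "p = (if e = N - 1 then s else s + 1 + e)"
    have s: "s + 1 = r + N" using N_big by (simp add: s_def)
    obtain b where b: "b x = s" "b y = s + 1"
      "map b zs = [s + 4..<s + 4 + length zs]" "cyclic_order (x # y # zs) b"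
      using lift[of s "s + 1" "s + 4"] N_big by auto
    have "p < s + 3" "s \<le> p" using far N_big by (auto simp: p_def)
    then have "cyclic_order (y # x # zs) (b(x := s + 3, y := p))"
      by (intro lift'[of _ "s + 4"]) (use b xy N_big in \<open>auto simp: keep\<close>)
    moreover have "p mod N = (r + e) mod N"
    proof (cases "e = N - 1")
      case True
      then show ?thesis using N_big by (simp add: p_def s_def)
    next
      case False
      have "p = (r + e) + N" using s False by (simp add: p_def)
      then show ?thesis by (simp only: mod_add_self2)
    qed
    moreover have "s + 4 \<le> b l" if "l \<in> set zs" for l
    proof -
      have "b l \<in> set (map b zs)" using that by simp
      then show ?thesis unfolding b(3) by simp
    qed
    moreover have "(s + 1) mod N = r" using s re by simp
    ultimately show ?thesis
      using reachable_by_far_jump[OF _ assms b(4,1,2), of r e p] jt far(2) by simp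
  next
    case near
    \<comment> \<open>A short jump with such an offset is the diagonal that its quadrilateral lacks,
      so the other diagonal is an edge.\<close>
    have dist: "(e = 1 \<and> w = v + N + 1 \<and> flipped N X v) \<or> (e = N - 1 \<and> w + 1 = v + N \<and> \<not> flipped N X (v - 1))"
      if v: "N \<le> v" "v < w" "\<not> spiral_adj t N X v w" "jump_type v w = (r, e, near)" for v w
    proof -
      define D where "D = w - v"
      have D: "D < 2 * N - 1" "D mod N = e" "w = v + D" "0 < D"
        using v(2,4) near(2) by (auto simp: jump_type_def D_def)
      have "D = e \<or> D = e + N"
      proof (cases "D < N")
        case True
        then show ?thesis using D(2) by simp
      next
        case False
        then have "D mod N = D - N" using D(1) by (subst le_mod_geq) auto
        then show ?thesis using False D(2) by simp
      qed
      moreover have "\<not> spiral_up t N X v w" using v(2,3) spiral_adj_less by simp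
      then have "w \<noteq> v + 1" "w \<noteq> v + N" "w = v + N + 1 \<longrightarrow> flipped N X v"
        "w + 1 = v + N \<longrightarrow> \<not> flipped N X (v - 1)"
        using spiral_up_far[OF v(1)] by auto
      ultimately show ?thesis
        using near(1) D(1,3,4) N_big by (elim disjE) simp_all
    qed
    have e: "e = 1 \<or> e = N - 1" using dist v0 by blast
    \<comment> \<open>Class of the first corner of the quadrilateral; the jump starts there if
      \<open>e = 1\<close> and at the next vertex otherwise. Adding \<open>N\<close> avoids
      truncated subtraction.\<close>
    define s where "s = (if e = 1 then r else r + N - 1)"
    obtain b where b: "b x = s" "b y = s + 1" "cyclic_order (x # y # zs) b"
      using lift[of s "s + 1" "s + 2"] N_big by auto
    show ?thesis
    proof (rule reachable_by_crossing[OF _ assms b(3,1,2)])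
      fix m :: nat and Q :: "'a set" assume "finite Q"
      from jt[OF this, of "m + N + 1"] obtain v w Zs where v: "m + N + 1 \<le> v" "v < w"
        "\<not> spiral_adj t N X v w" "jump V E f v w Zs" "set Zs \<inter> Q = {}" "jump_type v w = (r, e, near)"
        by blast
      have r: "v mod N = r" using v(6) by (simp add: jump_type_def)
      have edge: "jump V E f i j []" if "N \<le> i" "i < j" "spiral_up t N X i j" for i j
        using that jump_edge[of E f i j V] hom_f[of i j] spiral_adj_less by blast
      show "\<exists>u Zs Zs'. m \<le> u \<and> u mod N = s mod N \<and> jump V E f u (u + N + 1) Zs \<and>
        jump V E f (u + 1) (u + N) Zs' \<and> set Zs \<inter> Q = {} \<and> set Zs' \<inter> Q = {} \<and> set Zs \<inter> set Zs' = {}"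
      proof (cases "e = 1")
        case True
        then have "w = v + N + 1" "flipped N X v" using dist[OF _ v(2,3,6)] v(1) N_big by auto
        moreover from this have "jump V E f (v + 1) (v + N) []"
          using v(1) N_big by (intro edge) (auto simp: spiral_up_far)
        moreover have "v mod N = s mod N" using r True by (auto simp: s_def)
        ultimately show ?thesis using v(1,4,5) by (intro exI[of _ v] exI[of _ Zs] exI[of _ "[]"]) auto
      next
        case False
        then have eN: "e = N - 1" using e by simp
        define u where "u = v - 1"
        have u: "v = u + 1" "m + N \<le> u" using v(1) by (auto simp: u_def)
        have "w = u + N" "\<not> flipped N X u"
          using dist[OF _ v(2,3,6)] u False by auto
        moreover from this have "jump V E f u (u + N + 1) []"
          using u by (intro edge) (auto simp: spiral_up_far)
        moreover have "u mod N = s mod N"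
        proof -
          have "(u + 1 + (N - 1)) mod N = (r + (N - 1)) mod N"
            using r u(1) by (intro mod_add_cong) (use re in simp_all)
          moreover have "u + 1 + (N - 1) = u + N" "r + (N - 1) = s"
            using False N_big by (auto simp: s_def)
          ultimately show ?thesis by (simp only: mod_add_self2)
        qed
        ultimately show ?thesis using v(4,5) u
          by (intro exI[of _ u] exI[of _ "[]"] exI[of _ Zs]) auto
      qed
    qed
  qed
qed

text \<open>Rotations bring any neighbouring pair to the front, where it can be exchanged; such
  transpositions generate all permutations.\<close>

lemma reachable_order_all:
  assumes "reachable_order xs" "mset xs = mset ys" shows "reachable_order ys"
proof (rule mset_eq_by_adjacent_swaps[where R = reachable_order, OF _ assms(2,1)])
  fix us vs x y
  have rot: "reachable_order (as @ bs) \<Longrightarrow> reachable_order (bs @ as)" for as bs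
  proof (induction as arbitrary: bs)
    case (Cons a as)
    then have "reachable_order (as @ (bs @ [a]))" using reachable_order_rotate[of a "as @ bs"] by simp
    then show ?case using Cons.IH[of "bs @ [a]"] by simp
  qed simp
  assume "reachable_order (us @ x # y # vs)"
  then have "reachable_order (x # y # (vs @ us))" using rot[of us "x # y # vs"] by simp
  then have "reachable_order ((y # x # vs) @ us)" using reachable_order_swap by fastforce
  then show "reachable_order (us @ y # x # vs)" by (rule rot)
qed

end

section \<open>Subdivisions\<close>

definition has_thick_subdivision :: "nat \<Rightarrow> 'a set \<Rightarrow> ('a \<Rightarrow> 'a \<Rightarrow> bool) \<Rightarrow> bool" where
  "has_thick_subdivision t V E \<longleftrightarrow> (\<exists>(w :: nat \<Rightarrow> 'a) (P :: nat \<Rightarrow> nat \<Rightarrow> nat \<Rightarrow> 'a list).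
     inj_on w {..<t} \<and> w ` {..<t} \<subseteq> V \<and>
     (\<forall>i j k. i < j \<and> j < t \<and> k < t \<longrightarrow>
        graph_path V E (P i j k) \<and> hd (P i j k) = w i \<and> last (P i j k) = w j \<and>
        interior_vertices (P i j k) \<inter> w ` {..<t} = {}) \<and>
     (\<forall>i j k i' j' k'. i < j \<and> j < t \<and> k < t \<and> i' < j' \<and> j' < t \<and> k' < t \<and>
        (i, j, k) \<noteq> (i', j', k') \<longrightarrow>
        P i j k \<noteq> P i' j' k' \<and>
        interior_vertices (P i j k) \<inter> interior_vertices (P i' j' k') = {}))"

lemma interior_vertices_ends [simp]: "interior_vertices (x # L @ [y]) = set L"
  by (simp add: interior_vertices_def butlast_append)

text \<open>With nonempty interiors, disjointness forces the paths to be different.\<close>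

lemma has_thick_subdivisionI:
  assumes w: "inj_on w {..<t}" "w ` {..<t} \<subseteq> V"
    and L: "\<And>i j k. i < j \<Longrightarrow> j < t \<Longrightarrow> k < t \<Longrightarrow>
      L i j k \<noteq> [] \<and> graph_path V E (w i # L i j k @ [w j])"
    and new: "\<And>i j k. i < j \<Longrightarrow> j < t \<Longrightarrow> k < t \<Longrightarrow> set (L i j k) \<inter> w ` {..<t} = {}"
    and disj: "\<And>i j k i' j' k'. i < j \<Longrightarrow> j < t \<Longrightarrow> k < t \<Longrightarrow> i' < j' \<Longrightarrow> j' < t \<Longrightarrow> k' < t \<Longrightarrow>
      (i, j, k) \<noteq> (i', j', k') \<Longrightarrow> set (L i j k) \<inter> set (L i' j' k') = {}"
  shows "has_thick_subdivision t V E"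
  unfolding has_thick_subdivision_def
proof (intro exI[of _ w] exI[of _ "\<lambda>i j k. w i # L i j k @ [w j]"] conjI allI impI)
  fix i j k assume "i < j \<and> j < t \<and> k < t"
  then show "graph_path V E (w i # L i j k @ [w j])" using L by blast
  show "interior_vertices (w i # L i j k @ [w j]) \<inter> w ` {..<t} = {}"
    using new \<open>i < j \<and> j < t \<and> k < t\<close> by simp
next
  fix i j k i' j' k'
  assume a: "i < j \<and> j < t \<and> k < t \<and> i' < j' \<and> j' < t \<and> k' < t \<and> (i, j, k) \<noteq> (i', j', k')"
  then have d: "set (L i j k) \<inter> set (L i' j' k') = {}" using disj by blast
  then show "interior_vertices (w i # L i j k @ [w j]) \<inter>
      interior_vertices (w i' # L i' j' k' @ [w j']) = {}" by simp
  have "set (L i j k) \<noteq> {}" using L[of i j k] a by simp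
  then have "set (L i j k) \<noteq> set (L i' j' k')" using d by (metis Int_absorb)
  then show "w i # L i j k @ [w j] \<noteq> w i' # L i' j' k' @ [w j']"
  proof (rule contrapos_nn)
    assume "w i # L i j k @ [w j] = w i' # L i' j' k' @ [w j']"
    from arg_cong[OF this, of interior_vertices] show "set (L i j k) = set (L i' j' k')" by simp
  qed
qed (use w in simp_all)

text \<open>Finitely many paths are chosen one by one, each avoiding the branch vertices and the
  interiors chosen before.\<close>

lemma has_thick_subdivision_greedy:
  assumes w: "inj_on w {..<t}" "w ` {..<t} \<subseteq> V"
    and conn: "\<And>i j Q. i < j \<Longrightarrow> j < t \<Longrightarrow> finite Q \<Longrightarrow>
      \<exists>L. L \<noteq> [] \<and> graph_path V E (w i # L @ [w j]) \<and> set L \<inter> Q = {}"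
  shows "has_thick_subdivision t V E"
proof -
  define T where "T = {(i, j, k). i < j \<and> j < t \<and> k < t}"
  have "T \<subseteq> {..<t} \<times> {..<t} \<times> {..<t}" by (auto simp: T_def)
  then have "finite T" by (rule finite_subset) simp
  define good where "good \<tau> R \<longleftrightarrow> R \<noteq> [] \<and> graph_path V E (w (fst \<tau>) # R @ [w (fst (snd \<tau>))]) \<and>
    set R \<inter> w ` {..<t} = {}" for \<tau> :: "nat \<times> nat \<times> nat" and R
  have "\<exists>R. (\<forall>\<tau>\<in>T'. good \<tau> (R \<tau>)) \<and> (\<forall>\<tau>\<in>T'. \<forall>\<tau>'\<in>T'. \<tau> \<noteq> \<tau>' \<longrightarrow> set (R \<tau>) \<inter> set (R \<tau>') = {})"
    if "T' \<subseteq> T" for T'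
    using finite_subset[OF that \<open>finite T\<close>] that
  proof (induction T' rule: finite_induct)
    case empty
    then show ?case by simp
  next
    case (insert \<tau> T')
    then have "T' \<subseteq> T" by simp
    from insert.IH[OF this] obtain R where R: "\<forall>\<tau>\<in>T'. good \<tau> (R \<tau>)"
      "\<forall>\<tau>\<in>T'. \<forall>\<tau>'\<in>T'. \<tau> \<noteq> \<tau>' \<longrightarrow> set (R \<tau>) \<inter> set (R \<tau>') = {}"
      by (elim exE conjE) (rule that)
    obtain i j k where \<tau>: "\<tau> = (i, j, k)" by (cases \<tau>)
    then have "i < j" "j < t" using insert.prems by (auto simp: T_def)
    moreover have "finite (w ` {..<t} \<union> (\<Union>\<tau>\<in>T'. set (R \<tau>)))" using insert.hyps by simp
    ultimately obtain L where L: "L \<noteq> []" "graph_path V E (w i # L @ [w j])"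
      "set L \<inter> (w ` {..<t} \<union> (\<Union>\<tau>\<in>T'. set (R \<tau>))) = {}"
      using conn by blast
    have "good \<tau> L" using L \<tau> by (auto simp: good_def)
    moreover have "set L \<inter> set (R \<tau>') = {}" if "\<tau>' \<in> T'" for \<tau>' using L(3) that by blast
    ultimately have "\<forall>\<sigma>\<in>insert \<tau> T'. good \<sigma> ((R(\<tau> := L)) \<sigma>)"
      "\<forall>\<sigma>\<in>insert \<tau> T'. \<forall>\<sigma>'\<in>insert \<tau> T'. \<sigma> \<noteq> \<sigma>' \<longrightarrow>
         set ((R(\<tau> := L)) \<sigma>) \<inter> set ((R(\<tau> := L)) \<sigma>') = {}"
      using R insert.hyps(2) by (simp_all add: Int_commute)
    then show ?case by (intro exI[of _ "R(\<tau> := L)"] conjI)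
  qed
  from this[OF order_refl] obtain R where R: "\<forall>\<tau>\<in>T. good \<tau> (R \<tau>)"
    "\<forall>\<tau>\<in>T. \<forall>\<tau>'\<in>T. \<tau> \<noteq> \<tau>' \<longrightarrow> set (R \<tau>) \<inter> set (R \<tau>') = {}"
    by (elim exE conjE) (rule that)
  have in_T: "(i, j, k) \<in> T" if "i < j" "j < t" "k < t" for i j k using that by (simp add: T_def)
  show ?thesis
  proof (rule has_thick_subdivisionI[OF w, where L = "\<lambda>i j k. R (i, j, k)"])
    fix i j k assume "i < j" "j < t" "k < t"
    then have "good (i, j, k) (R (i, j, k))" using R(1)[rule_format, of "(i, j, k)"] in_T by simp
    then show "R (i, j, k) \<noteq> [] \<and> graph_path V E (w i # R (i, j, k) @ [w j])"
      "set (R (i, j, k)) \<inter> w ` {..<t} = {}" by (auto simp: good_def)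
  next
    fix i j k i' j' k' :: nat
    assume "i < j" "j < t" "k < t" "i' < j'" "j' < t" "k' < t" "(i, j, k) \<noteq> (i', j', k')"
    then show "set (R (i, j, k)) \<inter> set (R (i', j', k')) = {}"
      using R(2)[rule_format, of "(i, j, k)" "(i', j', k')"] in_T by simp
  qed
qed

context spiral begin

text \<open>Vertices outside the spiral with infinitely many neighbours on it are pairwise joined by
  infinitely many independent paths.\<close>

lemma has_thick_subdivision_of_apices:
  assumes symE: "\<And>x y. E x y \<Longrightarrow> E y x"
    and f: "inj f" "range f \<subseteq> V" "\<And>i j. spiral_adj t N X i j \<Longrightarrow> E (f i) (f j)"
    and w: "inj_on w {..<t}" "w ` {..<t} \<subseteq> V - range f"
    and apex: "\<And>i. i < t \<Longrightarrow> infinite {j. E (w i) (f j)}"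
  shows "has_thick_subdivision t V E"
proof (rule has_thick_subdivision_greedy[OF w(1)])
  show "w ` {..<t} \<subseteq> V" using w by blast
  fix i j and Q :: "'a set" assume ij: "i < j" "j < t" and "finite Q"
  have "finite (f -` Q)" by (rule finite_vimageI[OF \<open>finite Q\<close> f(1)])
  then obtain m where m: "\<And>n. f n \<in> Q \<Longrightarrow> n < m"
    by (metis finite_nat_set_iff_bounded vimage_eq)
  have "\<exists>n\<ge>max m N. E (w i) (f n)" if "i < t" for i
    using apex[OF that] by (metis (mono_tags) infinite_nat_iff_unbounded_le mem_Collect_eq)
  then obtain a b where a: "m \<le> a" "N \<le> a" "E (w i) (f a)" and b: "m \<le> b" "N \<le> b" "E (w j) (f b)"
    using ij by (metis max.bounded_iff order_less_trans)
  have run: "successively E (map f [p..<q])" if "N \<le> p" for p q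
    unfolding successively_conv_nth
  proof (intro allI impI)
    fix s assume "Suc s < length (map f [p..<q])"
    moreover have "spiral_adj t N X (p + s) (p + Suc s)"
      using that by (simp add: spiral_adj_less spiral_up_far)
    ultimately show "E (map f [p..<q] ! s) (map f [p..<q] ! Suc s)" using f(3) by simp
  qed
  define L where "L = (if a \<le> b then map f [a..<Suc b] else rev (map f [b..<Suc a]))"
  have run': "successively E (rev (map f [b..<Suc a]))"
  proof -
    have "successively (\<lambda>x y. E y x) (map f [b..<Suc a])"
      by (rule successively_mono[OF run[OF b(2)]]) (rule symE)
    then show ?thesis by (subst successively_rev)
  qed
  have L: "L \<noteq> []" "hd L = f a" "last L = f b" "successively E L"
    using run[OF a(2), of "Suc b"] run'
    by (auto simp: L_def hd_rev last_rev hd_map last_map simp del: upt_Suc)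
  have "distinct (map f [p..<q])" for p q
    using inj_on_subset[OF f(1)] by (simp add: distinct_map)
  then have "distinct L" unfolding L_def by (simp only: distinct_rev split: if_split) simp
  have setL: "set L \<subseteq> f ` {min a b..}" by (auto simp: L_def)
  have "w i \<in> V - range f" "w j \<in> V - range f"
    using ij by (intro subsetD[OF w(2)] imageI; simp)+
  moreover have "w i \<noteq> w j" using inj_onD[OF w(1), of i j] ij by auto
  ultimately have wi: "w i \<in> V - range f" "w j \<in> V - range f" "w i \<noteq> w j" by simp_all
  have "successively E (w i # L @ [w j])"
    using L a(3) symE[OF b(3)] by (auto simp: successively_append_iff successively_Cons)
  then have "graph_path V E (w i # L @ [w j])"
    using wi setL f(2) \<open>distinct L\<close> unfolding graph_path_iff by auto
  moreover have "set L \<inter> Q = {}" using setL m a(1) b(1) by fastforce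
  ultimately show "\<exists>L. L \<noteq> [] \<and> graph_path V E (w i # L @ [w j]) \<and> set L \<inter> Q = {}"
    using L(1) by blast
qed

end

section \<open>The subdivision obtained from paired paths\<close>

context jumping_spiral begin

text \<open>Digits in base \<open>t\<close>: the path starts in the fan of centre \<open>i\<close>
  and serves the \<open>k\<close>-th connection to centre \<open>j\<close>. The labels with first
  digit \<open>i\<close> fill precisely the fan of \<open>i\<close>.\<close>

definition label :: "nat \<Rightarrow> nat \<Rightarrow> nat \<Rightarrow> nat" where
  "label i j k = (i * t + j) * t + k"

lemma label_inj:
  assumes "label i j k = label i' j' k'" "j < t" "k < t" "j' < t" "k' < t"
  shows "i = i' \<and> j = j' \<and> k = k'"
proof -
  have "label i j k mod t = k" "label i j k div t = i * t + j"
    "label i' j' k' mod t = k'" "label i' j' k' div t = i' * t + j'"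
    using assms(2-) by (simp_all add: label_def)
  then have k: "k = k'" and ij: "i * t + j = i' * t + j'" using assms(1) by metis+
  have "(i * t + j) mod t = j" "(i * t + j) div t = i"
    "(i' * t + j') mod t = j'" "(i' * t + j') div t = i'"
    using assms(2-) by simp_all
  then show ?thesis using k ij by metis
qed

lemma label_bounds:
  assumes "i < t" "j < t" "k < t"
  shows "i * t\<^sup>2 \<le> label i j k" "label i j k < (i + 1) * t\<^sup>2" "label i j k < M"
proof -
  have "j * t + k < (j + 1) * t" using assms by simp
  also have "\<dots> \<le> t * t" using assms by (intro mult_right_mono) auto
  finally have "j * t + k < t\<^sup>2" by (simp add: power2_eq_square)
  then show *: "i * t\<^sup>2 \<le> label i j k" "label i j k < (i + 1) * t\<^sup>2"
    by (simp_all add: label_def power2_eq_square algebra_simps)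
  then show "label i j k < M" using fan_bound[OF assms(1)] by simp
qed

lemma reachable_order_initial: "reachable_order [0..<M]"
proof (rule reachable_orderI[of "{}"])
  show "cyclic_order [0..<M] (\<lambda>k. k)"
    using N_big unfolding cyclic_order_def by auto
  have "linked (\<lambda>k. N + k) ({N..<2 * N} \<union> (\<lambda>_. 0) ` ({..<M} - {..<M})) {}"
    unfolding linked_def
  proof (intro exI[of _ "\<lambda>k. [f (N + k)]"] conjI allI impI)
    fix k assume "k < M"
    then show "graph_path V E [f (N + k)]" using range_f by (auto simp: graph_path_iff)
    show "set [f (N + k)] \<subseteq> f ` ({N..<2 * N} \<union> (\<lambda>_. 0) ` ({..<M} - {..<M})) \<union> {}"
      using \<open>k < M\<close> N_big by auto
  next
    fix k l :: nat assume "k \<noteq> l"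
    then show "set [f (N + k)] \<inter> set [f (N + l)] = {}" using inj_f by (auto dest: injD)
  qed simp_all
  then show "placed (2 * N) (\<lambda>k. k) {..<M} (\<lambda>_. 0) {}"
    using N_big unfolding placed_def by (intro conjI exI[of _ "\<lambda>k. N + k"]) auto
qed simp

text \<open>The paths for \<open>(i, j, k)\<close> and \<open>(j, i, k)\<close> are brought next to each other and then joined.\<close>

lemma paired_order:
  obtains b ys where "cyclic_order ys b" "mset ys = mset [0..<M]" "\<And>k. k < M \<Longrightarrow> b k < M"
    "\<And>i j k. i < j \<Longrightarrow> j < t \<Longrightarrow> k < t \<Longrightarrow> b (label j i k) = b (label i j k) + 1"
proof -
  define T where "T = {(i, j, k). i < j \<and> j < t \<and> k < t}"
  have "T \<subseteq> {..<t} \<times> {..<t} \<times> {..<t}" by (auto simp: T_def)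
  then have "finite T" by (rule finite_subset) simp
  then obtain ps where ps: "set ps = T" "distinct ps" using finite_distinct_list by blast
  define pr where "pr = (\<lambda>(i, j, k). [label i j k, label j i k])"
  define xs where "xs = concat (map pr ps)"
  have pr: "pr (i, j, k) = [label i j k, label j i k]" for i j k by (simp add: pr_def)
  have same: "\<tau> = \<tau>'" if \<tau>: "\<tau> \<in> T" "\<tau>' \<in> T" and l: "l \<in> set (pr \<tau>)" "l \<in> set (pr \<tau>')" for \<tau> \<tau>' l
  proof -
    obtain i j k i' j' k' where eq: "\<tau> = (i, j, k)" "\<tau>' = (i', j', k')"
      by (cases \<tau>; cases \<tau>')
    have lt: "i < j" "j < t" "k < t" "i < t" "i' < j'" "j' < t" "k' < t" "i' < t"
      using \<tau> eq by (auto simp: T_def)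
    have "l = label i j k \<or> l = label j i k" "l = label i' j' k' \<or> l = label j' i' k'"
      using l eq pr by auto
    then consider "label i j k = label i' j' k'" | "label i j k = label j' i' k'"
      | "label j i k = label i' j' k'" | "label j i k = label j' i' k'" by metis
    then show ?thesis
      by cases (use label_inj[of i j k i' j' k'] label_inj[of i j k j' i' k']
        label_inj[of j i k i' j' k'] label_inj[of j i k j' i' k'] lt eq in auto)
  qed
  have "distinct xs"
    unfolding xs_def
  proof (rule distinct_concat)
    have "inj_on pr T"
    proof (rule inj_onI)
      fix \<tau> \<tau>' assume *: "\<tau> \<in> T" "\<tau>' \<in> T" "pr \<tau> = pr \<tau>'"
      then show "\<tau> = \<tau>'" using same[OF *(1,2), of "hd (pr \<tau>)"] by (auto simp: pr_def split: prod.splits)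
    qed
    then show "distinct (map pr ps)" using ps by (simp add: distinct_map)
  next
    fix l assume "l \<in> set (map pr ps)"
    then obtain i j k where "l = pr (i, j, k)" "i < j" "j < t" "k < t" using ps by (auto simp: T_def)
    then show "distinct l" using label_inj[of i j k j i k] by (auto simp: pr)
  next
    fix l l' assume "l \<in> set (map pr ps)" "l' \<in> set (map pr ps)" "l \<noteq> l'"
    then obtain \<tau> \<tau>' where \<tau>: "\<tau> \<in> T" "\<tau>' \<in> T" "l = pr \<tau>" "l' = pr \<tau>'" "\<tau> \<noteq> \<tau>'"
      using ps(1) unfolding set_map by blast
    show "set l \<inter> set l' = {}" using same[OF \<tau>(1,2)] \<tau>(3-5) by blast
  qed
  have "set xs \<subseteq> {..<M}"
  proof
    fix l assume "l \<in> set xs"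
    then obtain i j k where "i < j" "j < t" "k < t" "l = label i j k \<or> l = label j i k"
      using ps(1) by (auto simp: xs_def pr_def T_def)
    then show "l \<in> {..<M}" using label_bounds(3)[of i j k] label_bounds(3)[of j i k] by auto
  qed
  \<comment> \<open>The remaining labels, those with \<open>i = j\<close>, are appended so that all
    \<open>M\<close> paths are ordered.\<close>
  define ys where "ys = xs @ filter (\<lambda>k. k \<notin> set xs) [0..<M]"
  have ys: "distinct ys" "set ys = {..<M}"
    using \<open>distinct xs\<close> \<open>set xs \<subseteq> {..<M}\<close> by (auto simp: ys_def)
  then have m: "mset ys = mset [0..<M]"
    by (metis atLeast_upt distinct_upt set_eq_iff_mset_eq_distinct)
  then have "length [0..<M] = length ys" by (metis size_mset)
  from exists_map_eq[OF ys(1) this] obtain b where b: "map b ys = [0..<M]" by (rule exE)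
  have nth: "b (ys ! p) = p" if "p < M" for p
  proof -
    have "b (ys ! p) = map b ys ! p" using that \<open>length [0..<M] = length ys\<close> by simp
    then show ?thesis using that by (simp add: b)
  qed
  show ?thesis
  proof (rule that[of ys b])
    show "cyclic_order ys b" by (rule cyclic_order_of_lifts[OF ys b]) (use N_big in auto)
    show "mset ys = mset [0..<M]" by (rule m)
    show "b k < M" if "k < M" for k
    proof -
      have "b k \<in> set (map b ys)" using that ys(2) by simp
      then show ?thesis unfolding b by simp
    qed
    fix i j k assume "i < j" "j < t" "k < t"
    then have "(i, j, k) \<in> set ps" using ps by (simp add: T_def)
    then obtain as bs where "ps = as @ (i, j, k) # bs" by (meson split_list)
    then obtain us vs where us: "ys = us @ label i j k # label j i k # vs"
      by (auto simp: ys_def xs_def pr)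
    then have "length us + 1 < M" using \<open>length [0..<M] = length ys\<close> by simp
    then have "b (ys ! length us) = length us" "b (ys ! (length us + 1)) = length us + 1"
      using nth by simp_all
    then show "b (label j i k) = b (label i j k) + 1" by (simp add: us nth_append)
  qed
qed

lemma has_thick_subdivision_of_jumps: "has_thick_subdivision t V E"
proof -
  obtain b ys where b: "cyclic_order ys b" "mset ys = mset [0..<M]" "\<And>k. k < M \<Longrightarrow> b k < M"
    "\<And>i j k. i < j \<Longrightarrow> j < t \<Longrightarrow> k < t \<Longrightarrow> b (label j i k) = b (label i j k) + 1"
    by (rule paired_order) (rule that)
  have "reachable_order ys" using reachable_order_all[OF reachable_order_initial] b(2) by simp
  then obtain n0 Z where n0: "2 * N \<le> n0" "placed n0 b {..<M} (\<lambda>_. 0) Z"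
    using b(1) by (rule reachable_orderE)
  \<comment> \<open>At a multiple of \<open>N\<close> the last turn runs through the classes in
    increasing order, so the tips are \<open>n - N + b k\<close> and paired paths end at consecutive
    vertices.\<close>
  define n where "n = N * n0"
  have "1 * n0 \<le> N * n0" using N_big by (intro mult_right_mono) auto
  then have "n0 \<le> n" by (simp add: n_def)
  then have "placed n b {..<M} (\<lambda>_. 0) Z" using placed_wait_all[OF n0(2)] by blast
  then obtain c where Z: "Z \<inter> range f = {}" and lk: "linked c ({N..<n} \<union> (\<lambda>_. 0) ` ({..<M} - {..<M})) Z"
    and c: "\<And>k. k < M \<Longrightarrow> n \<le> c k + N \<and> c k < n \<and> c k mod N = b k mod N"
    unfolding placed_def by auto
  have "linked c {N..<n} Z" using lk by simp
  then obtain P where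
    P: "\<And>k. k < M \<Longrightarrow> graph_path V E (P k) \<and> hd (P k) = f (N + k) \<and> last (P k) = f (c k) \<and>
      set (P k) \<subseteq> f ` {N..<n} \<union> Z"
    and dj: "\<And>k l. k < M \<Longrightarrow> l < M \<Longrightarrow> k \<noteq> l \<Longrightarrow> set (P k) \<inter> set (P l) = {}"
    unfolding linked_def by blast
  have nN: "2 * N \<le> n" using n0(1) \<open>n0 \<le> n\<close> by simp
  have c_eq: "c k = n - N + b k" if "k < M" for k
  proof (rule mod_eq_close)
    have "n - N + b k = N * (n0 - 1) + b k" by (simp add: n_def diff_mult_distrib2)
    then show "c k mod N = (n - N + b k) mod N" using c[OF that] by simp
  qed (use c[OF that] b(3)[OF that] nN N_big in auto)
  define w where "w i = f (i * t\<^sup>2)" for i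
  \<comment> \<open>Out from centre \<open>i\<close>, across the spiral edge between the two tips,
    and back to centre \<open>j\<close>.\<close>
  define L where "L i j k = P (label i j k) @ rev (P (label j i k))" for i j k
  have centre: "i * t\<^sup>2 < N" if "i < t" for i using fan_bound[OF that] N_big by simp
  have lab: "label i j k < M" "label j i k < M" "label i j k \<noteq> label j i k"
    if "i < j" "j < t" "k < t" for i j k
    using label_bounds(3)[of i j k] label_bounds(3)[of j i k] label_inj[of i j k j i k] that by auto
  have off: "w i \<notin> set (P l)" if "i < t" "l < M" for i l
  proof
    assume "w i \<in> set (P l)"
    then have "w i \<in> f ` {N..<n}" using P[OF that(2)] Z by (auto simp: w_def)
    then have "i * t\<^sup>2 \<in> {N..<n}" using inj_f by (simp add: w_def inj_image_mem_iff)
    then show False using centre[OF that(1)] by simp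
  qed
  have inj_w: "inj_on w {..<t}"
  proof (rule inj_onI)
    fix i j assume "i \<in> {..<t}" "j \<in> {..<t}" "w i = w j"
    then show "i = j" using injD[OF inj_f, of "i * t\<^sup>2" "j * t\<^sup>2"] by (auto simp: w_def)
  qed
  have fan: "E (w i) (f (N + label i j k))" if "i < t" "j < t" "k < t" for i j k
  proof -
    have "spiral_up t N X (i * t\<^sup>2) (N + label i j k)"
      unfolding spiral_up_def using that(1) label_bounds[OF that] by auto
    then show ?thesis unfolding w_def using hom_f unfolding spiral_adj_def by blast
  qed
  show ?thesis
  proof (rule has_thick_subdivisionI[OF inj_w, where L = L])
    show "w ` {..<t} \<subseteq> V" using range_f by (auto simp: w_def)
    fix i j k assume ijk: "i < j" "j < t" "k < t"
    then have it: "i < t" by simp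
    note l = lab[OF ijk]
    have "spiral_adj t N X (c (label i j k)) (c (label j i k))"
      using c_eq[OF l(1)] c_eq[OF l(2)] b(4)[OF ijk] nN N_big
      by (simp add: spiral_adj_less spiral_up_far)
    then have "E (f (c (label i j k))) (f (c (label j i k)))" by (rule hom_f)
    moreover have "successively E (rev (P (label j i k)))"
    proof -
      have "successively (\<lambda>x y. E y x) (P (label j i k))"
        using P[OF l(2)] symE unfolding graph_path_iff by (auto elim: successively_mono)
      then show ?thesis by (subst successively_rev)
    qed
    ultimately have "successively E (w i # L i j k @ [w j])"
      using P[OF l(1)] P[OF l(2)] fan[OF it ijk(2,3)] symE[OF fan[OF ijk(2) it ijk(3)]]
      unfolding graph_path_iff L_def
      by (auto simp: successively_append_iff successively_Cons hd_rev last_rev)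
    moreover have "w i \<noteq> w j" using inj_onD[OF inj_w, of i j] ijk it by auto
    moreover have "w i \<in> V" "w j \<in> V" using range_f by (auto simp: w_def)
    moreover have "w i \<notin> set (L i j k)" "w j \<notin> set (L i j k)"
      using off it ijk(2) l by (auto simp: L_def)
    moreover have "distinct (L i j k)" "set (L i j k) \<subseteq> V" "L i j k \<noteq> []"
      using P[OF l(1)] P[OF l(2)] dj[OF l] unfolding graph_path_iff L_def by auto
    ultimately show "L i j k \<noteq> [] \<and> graph_path V E (w i # L i j k @ [w j])"
      unfolding graph_path_iff by auto
    show "set (L i j k) \<inter> w ` {..<t} = {}" using off l by (auto simp: L_def)
  next
    fix i j k i' j' k'
    assume a: "i < j" "j < t" "k < t" "i' < j'" "j' < t" "k' < t" "(i, j, k) \<noteq> (i', j', k')"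
    note l = lab[OF a(1-3)] and l' = lab[OF a(4-6)]
    have "label i j k \<noteq> label i' j' k'" "label i j k \<noteq> label j' i' k'"
      "label j i k \<noteq> label i' j' k'" "label j i k \<noteq> label j' i' k'"
      using label_inj[of i j k i' j' k'] label_inj[of i j k j' i' k']
        label_inj[of j i k i' j' k'] label_inj[of j i k j' i' k'] a by auto
    then show "set (L i j k) \<inter> set (L i' j' k') = {}"
      unfolding L_def using dj l l' by (simp add: Int_Un_distrib Int_Un_distrib2)
  qed
qed

end

section \<open>Uncountably many embeddings\<close>

lemma uncountable_nat_sets: "uncountable (UNIV :: nat set set)"
  unfolding uncountable_def using Cantors_theorem[of "UNIV :: nat set"] by auto

lemma uncountable_fibre:
  assumes "uncountable A" "countable (h ` A)"
  obtains c where "uncountable {x \<in> A. h x = c}"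
proof (rule ccontr)
  assume "\<not> thesis"
  then have "countable {x \<in> A. h x = c}" for c using that by blast
  then have "countable (\<Union>c\<in>h ` A. {x \<in> A. h x = c})" using assms(2) by blast
  moreover have "(\<Union>c\<in>h ` A. {x \<in> A. h x = c}) = A" by blast
  ultimately show False using assms(1) by simp
qed

text \<open>If each \<open>X\<close> were separated from the others at a finite depth
  \<open>m X\<close>, the initial segments up to that depth would encode \<open>A\<close>
  injectively in a countable set. Since \<open>key\<close> records the depth, equal keys compare
  segments of equal length.\<close>

lemma exists_accumulation:
  fixes F :: "nat set \<Rightarrow> nat \<Rightarrow> 'a"
  assumes "uncountable A" "countable V" "\<And>X. X \<in> A \<Longrightarrow> range (F X) \<subseteq> V"
  shows "\<exists>X\<in>A. \<forall>m. \<exists>Y\<in>A. Y \<noteq> X \<and> (\<forall>j<m. F X j = F Y j \<and> (j \<in> X \<longleftrightarrow> j \<in> Y))"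
proof (rule ccontr)
  define key where "key m X = (m, map (F X) [0..<m], map (\<lambda>j. j \<in> X) [0..<m])" for m X
  assume "\<not> ?thesis"
  then obtain m where
    m: "\<And>X Y. X \<in> A \<Longrightarrow> Y \<in> A \<Longrightarrow> Y \<noteq> X \<Longrightarrow> \<not> (\<forall>j<m X. F X j = F Y j \<and> (j \<in> X \<longleftrightarrow> j \<in> Y))"
    by metis
  have "inj_on (\<lambda>X. key (m X) X) A"
  proof (rule inj_onI, rule ccontr)
    fix X Y assume "X \<in> A" "Y \<in> A" "key (m X) X = key (m Y) Y" "X \<noteq> Y"
    then show False using m[of X Y] by (auto simp: key_def)
  qed
  moreover have "(\<lambda>X. key (m X) X) ` A \<subseteq> UNIV \<times> lists V \<times> UNIV"
    using subsetD[OF assms(3) rangeI] by (auto simp: key_def)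
  then have "countable ((\<lambda>X. key (m X) X) ` A)"
    by (rule countable_subset) (intro countable_SIGMA countable_lists assms(2) countableI_type)
  ultimately show False using assms(1) countable_image_inj_on by blast
qed

theorem mainTheorem6:
  fixes V :: "'a set" and E :: "'a \<Rightarrow> 'a \<Rightarrow> bool" and t :: nat
  assumes "simple_graph V E" and "countable V"
    and "\<And>(W :: nat set) F. simple_graph W F \<Longrightarrow> planar_graph W F \<Longrightarrow> contains_graph V E W F"
  shows "\<exists>(w :: nat \<Rightarrow> 'a) (P :: nat \<Rightarrow> nat \<Rightarrow> nat \<Rightarrow> 'a list).
     inj_on w {..<t} \<and> w ` {..<t} \<subseteq> V \<and>
     (\<forall>i j k. i < j \<and> j < t \<and> k < t \<longrightarrow>
        graph_path V E (P i j k) \<and> hd (P i j k) = w i \<and> last (P i j k) = w j \<and>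
        interior_vertices (P i j k) \<inter> w ` {..<t} = {}) \<and>
     (\<forall>i j k i' j' k'. i < j \<and> j < t \<and> k < t \<and> i' < j' \<and> j' < t \<and> k' < t \<and>
        (i, j, k) \<noteq> (i', j', k') \<longrightarrow>
        P i j k \<noteq> P i' j' k' \<and>
        interior_vertices (P i j k) \<inter> interior_vertices (P i' j' k') = {})"
proof -
  define N where "N = 2 * t ^ 3 + 10"
  interpret spiral t N by unfold_locales (simp add: N_def)
  have symE: "E y x" if "E x y" for x y using assms(1) that by (auto simp: simple_graph_def)
  have "\<exists>f. inj f \<and> range f \<subseteq> V \<and> (\<forall>i j. spiral_adj t N X i j \<longrightarrow> E (f i) (f j))" for X
    using assms(3)[OF simple_spiral planar_spiral] unfolding contains_graph_def by auto
  then obtain F where F: "\<And>X. inj (F X)" "\<And>X. range (F X) \<subseteq> V"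
    "\<And>X i j. spiral_adj t N X i j \<Longrightarrow> E (F X i) (F X j)"
    by metis
  define Apex where "Apex X = {z \<in> V - range (F X). infinite {j. E z (F X j)}}" for X
  have "has_thick_subdivision t V E"
  proof (cases "\<forall>X. finite (Apex X) \<and> card (Apex X) < t")
    case False
    then obtain X where "infinite (Apex X) \<or> t \<le> card (Apex X)" by (meson not_less)
    then obtain S where S: "S \<subseteq> Apex X" "card S = t" "finite S"
      by (metis infinite_arbitrarily_large obtain_subset_with_card_n)
    obtain w where w: "bij_betw w {..<t} S"
      using ex_bij_betw_nat_finite[OF S(3)] S(2) by (auto simp: atLeast0LessThan)
    have "w i \<in> Apex X" if "i < t" for i using w S(1) that by (auto simp: bij_betw_def)
    then have "w ` {..<t} \<subseteq> V - range (F X)" "\<And>i. i < t \<Longrightarrow> infinite {j. E (w i) (F X j)}"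
      by (auto simp: Apex_def)
    then show ?thesis
      using has_thick_subdivision_of_apices[of E "F X" V X w] symE F w by (auto simp: bij_betw_def)
  next
    case True
    \<comment> \<open>A countable set has countably many finite subsets, so uncountably many
      embeddings share their apices.\<close>
    have "range Apex \<subseteq> {S. finite S \<and> S \<subseteq> V}" using True by (auto simp: Apex_def)
    then have "countable (range Apex)"
      using countable_Collect_finite_subset[OF assms(2)] countable_subset by blast
    then obtain S where S: "uncountable {X \<in> UNIV. Apex X = S}"
      by (rule uncountable_fibre[OF uncountable_nat_sets])
    from exists_accumulation[OF S assms(2), of F] F(2) obtain X where
      X: "Apex X = S" and near: "\<And>m. \<exists>Y. Apex Y = S \<and> Y \<noteq> X \<and>
        (\<forall>j<m. F X j = F Y j \<and> (j \<in> X \<longleftrightarrow> j \<in> Y))"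
      by auto
    interpret jumping_spiral t N V E "F X" X
    proof unfold_locales
      fix Q :: "'a set" and m assume "finite Q"
      \<comment> \<open>Outside vertices in \<open>Q\<close> that are no apices have only finitely
        many neighbours on the spiral.\<close>
      define B where "B = (\<Union>z\<in>Q \<inter> (V - range (F X) - S). {j. E z (F X j)})"
      have "finite B" using \<open>finite Q\<close> X by (auto simp: B_def Apex_def)
      then obtain p where p: "\<And>j. j \<in> B \<Longrightarrow> j < p" by (metis finite_nat_set_iff_bounded)
      \<comment> \<open>\<open>2 * N + 1\<close> is required of the first difference,
        \<open>m\<close> pushes the jump far enough out, and \<open>p\<close> puts the promised
        neighbours of \<open>Zs\<close> beyond \<open>B\<close>.\<close>
      define m' where "m' = 2 * N + 1 + m + p"
      obtain Y where Y: "Apex Y = S" "Y \<noteq> X"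
        "\<And>j. j < m' \<Longrightarrow> F X j = F Y j" "\<And>j. j < m' \<Longrightarrow> j \<in> X \<longleftrightarrow> j \<in> Y"
        using near[of m'] by blast
      have "2 * N + 1 \<le> m'" "X \<noteq> Y" using Y(2) by (auto simp: m'_def)
      then obtain v w Zs where J: "m' \<le> v + N + 1" "v < w" "\<not> spiral_adj t N X v w"
        "jump V E (F X) v w Zs" "set Zs \<subseteq> range (F Y)"
        "\<And>z. z \<in> set Zs \<Longrightarrow> \<exists>j. m' \<le> j + N + 1 \<and> E z (F X j)"
        using jump_of_difference[of E "F X" X "F Y" Y V m', OF symE F(1) F(3) F(1) F(3) F(2)] Y(3,4)
        by metis
      have "z \<notin> Q" if z: "z \<in> set Zs" for z
      proof
        assume "z \<in> Q"
        moreover have "z \<in> V - range (F X)" using J(4) z by (auto simp: jump_def)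
        \<comment> \<open>The vertices of \<open>Zs\<close> lie in the range of \<open>F Y\<close>,
          whereas the apices of \<open>F Y\<close>, again forming \<open>S\<close>, lie outside
          it.\<close>
        moreover have "z \<notin> S" using J(5) z Y(1) by (auto simp: Apex_def)
        ultimately have "{j. E z (F X j)} \<subseteq> B" by (auto simp: B_def)
        then show False using J(6)[OF z] p by (fastforce simp: m'_def)
      qed
      then show "\<exists>v w Zs. m \<le> v \<and> v < w \<and> \<not> spiral_adj t N X v w \<and>
        jump V E (F X) v w Zs \<and> set Zs \<inter> Q = {}"
        using J(1-4) by (intro exI[of _ v] exI[of _ w] exI[of _ Zs]) (auto simp: m'_def)
    qed (use symE F in auto)
    show ?thesis by (rule has_thick_subdivision_of_jumps)
  qed
  then show ?thesis unfolding has_thick_subdivision_def .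
qed

end
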